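(* Let $\mathcal A$ be an abelian category of finite length and let $X\in\mathcal A$ have nonisomorphic simple factors $\{S^i:i\in I\}$, with associated partial order $\preceq$ on $I$ (as defined in the context). Then for each q-set $K\subseteq I$ there exists a unique quotient object $Q=X/S$ of $X$ such that the simple factors in any composition series for $Q$ are isomorphic to $S^i$ for $i\in K$. This defines a one-to-one correspondence between quotient objects of $X$ and q-sets $K\subseteq I$.
   Context: An abelian category is of finite length if it is artinian and noetherian (all descending and all ascending chains of subobjects of any object stabilize). A composition series for $X$ is a filtration by subobjects $0=A_0\subset A_1\subset\cdots\subset A_n=X$ whose factors $S_k=A_k/A_{k-1}$ are all simple; by the Jordan--H\"older theorem the $S_k$ are independent of choices up to isomorphism and permutation. $X$ has nonisomorphic simple factors if $S_k\not\cong S_l$ for $1\le k<l\le n$. In that case let $I$ be an indexing set with $|I|=n$ and write $\{S_1,\ldots,S_n\}=\{S^i:i\in I\}$. For every composition series $0=B_0\subset B_1\subset\cdots\subset B_n=X$ with $T_k=B_k/B_{k-1}$ there is a unique bijection $\phi:I\to\{1,\ldots,n\}$ with $S^i\cong T_{\phi(i)}$ for all $i\in I$. The partial order $\preceq$ on $I$ is defined by: $i\preceq j$ if and only if $\phi(i)\le\phi(j)$ for all bijections $\phi$ arising in this way from composition series of $X$. A subset $K\subseteq I$ is a q-set if $i\in I$, $j\in K$ and $j\preceq i$ imply $i\in K$. A quotient object of $X$ is an equivalence class of surjective morphisms $\pi:X\to Q$, where $\pi:X\to Q$ and $\pi':X\to Q'$ are equivalent if $\pi'=h\circ\pi$ for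 an isomorphism $h:Q\to Q'$. "The simple factors are isomorphic to $S^i$ for $i\in K$" means that, up to isomorphism and order, the list of simple factors is $(S^i)_{i\in K}$, each occurring once. *)

theory Defs
  imports "HOL-Algebra.Group"
begin

text \<open>
  A category carries a set of objects and a set of arrows; every arrow has one source and one
  target, so Hom-sets for different pairs of objects are disjoint. Operations are
  only constrained on objects and composable (respectively parallel) arrows.
\<close>

record ('o, 'm) additive_data =
  objects :: "'o set"
  arrows :: "'m set"
  src :: "'m \<Rightarrow> 'o"
  tgt :: "'m \<Rightarrow> 'o"
  ident :: "'o \<Rightarrow> 'm"
  arr_comp :: "'m \<Rightarrow> 'm \<Rightarrow> 'm"  (infixr "\<cdot>\<index>" 70)
  arr_add :: "'m \<Rightarrow> 'm \<Rightarrow> 'm"  (infixl "\<boxplus>\<index>" 65)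
  zero_arr :: "'o \<Rightarrow> 'o \<Rightarrow> 'm"

definition Hom :: "('o, 'm) additive_data \<Rightarrow> 'o \<Rightarrow> 'o \<Rightarrow> 'm set" where
  "Hom \<A> X Y = {f \<in> arrows \<A>. src \<A> f = X \<and> tgt \<A> f = Y}"

definition monic :: "('o, 'm) additive_data \<Rightarrow> 'm \<Rightarrow> bool" where
  "monic \<A> i \<longleftrightarrow> i \<in> arrows \<A> \<and>
     (\<forall>W \<in> objects \<A>. \<forall>f \<in> Hom \<A> W (src \<A> i). \<forall>g \<in> Hom \<A> W (src \<A> i).
        i \<cdot>\<^bsub>\<A>\<^esub> f = i \<cdot>\<^bsub>\<A>\<^esub> g \<longrightarrow> f = g)"

definition epic :: "('o, 'm) additive_data \<Rightarrow> 'm \<Rightarrow> bool" where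
  "epic \<A> p \<longleftrightarrow> p \<in> arrows \<A> \<and>
     (\<forall>W \<in> objects \<A>. \<forall>f \<in> Hom \<A> (tgt \<A> p) W. \<forall>g \<in> Hom \<A> (tgt \<A> p) W.
        f \<cdot>\<^bsub>\<A>\<^esub> p = g \<cdot>\<^bsub>\<A>\<^esub> p \<longrightarrow> f = g)"

definition iso_arr :: "('o, 'm) additive_data \<Rightarrow> 'm \<Rightarrow> bool" where
  "iso_arr \<A> f \<longleftrightarrow> f \<in> arrows \<A> \<and>
     (\<exists>g \<in> Hom \<A> (tgt \<A> f) (src \<A> f).
        g \<cdot>\<^bsub>\<A>\<^esub> f = ident \<A> (src \<A> f) \<and> f \<cdot>\<^bsub>\<A>\<^esub> g = ident \<A> (tgt \<A> f))"

definition iso_obj :: "('o, 'm) additive_data \<Rightarrow> 'o \<Rightarrow> 'o \<Rightarrow> bool" where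
  "iso_obj \<A> X Y \<longleftrightarrow> (\<exists>f \<in> Hom \<A> X Y. iso_arr \<A> f)"

definition zero_object :: "('o, 'm) additive_data \<Rightarrow> 'o \<Rightarrow> bool" where
  "zero_object \<A> Z \<longleftrightarrow> Z \<in> objects \<A> \<and>
     (\<forall>Y \<in> objects \<A>. Hom \<A> Z Y = {zero_arr \<A> Z Y} \<and> Hom \<A> Y Z = {zero_arr \<A> Y Z})"

definition is_kernel :: "('o, 'm) additive_data \<Rightarrow> 'm \<Rightarrow> 'm \<Rightarrow> bool" where
  "is_kernel \<A> k f \<longleftrightarrow> f \<in> arrows \<A> \<and> k \<in> arrows \<A> \<and> tgt \<A> k = src \<A> f \<and>
     f \<cdot>\<^bsub>\<A>\<^esub> k = zero_arr \<A> (src \<A> k) (tgt \<A> f) \<and>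
     (\<forall>g \<in> arrows \<A>. tgt \<A> g = src \<A> f \<and> f \<cdot>\<^bsub>\<A>\<^esub> g = zero_arr \<A> (src \<A> g) (tgt \<A> f) \<longrightarrow>
        (\<exists>!h. h \<in> Hom \<A> (src \<A> g) (src \<A> k) \<and> k \<cdot>\<^bsub>\<A>\<^esub> h = g))"

definition is_cokernel :: "('o, 'm) additive_data \<Rightarrow> 'm \<Rightarrow> 'm \<Rightarrow> bool" where
  "is_cokernel \<A> c f \<longleftrightarrow> f \<in> arrows \<A> \<and> c \<in> arrows \<A> \<and> src \<A> c = tgt \<A> f \<and>
     c \<cdot>\<^bsub>\<A>\<^esub> f = zero_arr \<A> (src \<A> f) (tgt \<A> c) \<and>
     (\<forall>g \<in> arrows \<A>. src \<A> g = tgt \<A> f \<and> g \<cdot>\<^bsub>\<A>\<^esub> f = zero_arr \<A> (src \<A> f) (tgt \<A> g) \<longrightarrow>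
        (\<exists>!h. h \<in> Hom \<A> (tgt \<A> c) (tgt \<A> g) \<and> h \<cdot>\<^bsub>\<A>\<^esub> c = g))"

locale category_laws =
  fixes \<A> :: "('o, 'm) additive_data" (structure)
  assumes src_object: "f \<in> arrows \<A> \<Longrightarrow> src \<A> f \<in> objects \<A>"
    and tgt_object: "f \<in> arrows \<A> \<Longrightarrow> tgt \<A> f \<in> objects \<A>"
    and ident_Hom: "X \<in> objects \<A> \<Longrightarrow> ident \<A> X \<in> Hom \<A> X X"
    and comp_Hom: "f \<in> Hom \<A> X Y \<Longrightarrow> g \<in> Hom \<A> Y Z \<Longrightarrow> g \<cdot> f \<in> Hom \<A> X Z"
    and ident_left: "f \<in> Hom \<A> X Y \<Longrightarrow> ident \<A> Y \<cdot> f = f"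
    and ident_right: "f \<in> Hom \<A> X Y \<Longrightarrow> f \<cdot> ident \<A> X = f"
    and comp_assoc: "f \<in> Hom \<A> W X \<Longrightarrow> g \<in> Hom \<A> X Y \<Longrightarrow> h \<in> Hom \<A> Y Z \<Longrightarrow>
      (h \<cdot> g) \<cdot> f = h \<cdot> (g \<cdot> f)"

text \<open>
  The last axiom says that every \<open>f\<close> factors as \<open>K \<rightarrow> X \<rightarrow> J \<rightarrow> Y \<rightarrow> C\<close> with \<open>K\<close> and \<open>C\<close> its
  kernel and cokernel and \<open>J\<close> at once its coimage and its image.
\<close>

locale abelian_category = category_laws +
  assumes Hom_group: "X \<in> objects \<A> \<Longrightarrow> Y \<in> objects \<A> \<Longrightarrow>
      comm_group \<lparr>carrier = Hom \<A> X Y, mult = arr_add \<A>, one = zero_arr \<A> X Y\<rparr>"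
    and comp_add_right: "f \<in> Hom \<A> X Y \<Longrightarrow> f' \<in> Hom \<A> X Y \<Longrightarrow> g \<in> Hom \<A> Y Z \<Longrightarrow>
      g \<cdot> (f \<boxplus> f') = (g \<cdot> f) \<boxplus> (g \<cdot> f')"
    and comp_add_left: "f \<in> Hom \<A> X Y \<Longrightarrow> g \<in> Hom \<A> Y Z \<Longrightarrow> g' \<in> Hom \<A> Y Z \<Longrightarrow>
      (g \<boxplus> g') \<cdot> f = (g \<cdot> f) \<boxplus> (g' \<cdot> f)"
    and ex_zero_object: "\<exists>Z. zero_object \<A> Z"
    and ex_direct_sum: "X \<in> objects \<A> \<Longrightarrow> Y \<in> objects \<A> \<Longrightarrow>
      \<exists>Z \<in> objects \<A>. \<exists>\<iota> \<in> Hom \<A> X Z. \<exists>\<iota>' \<in> Hom \<A> Y Z. \<exists>\<pi> \<in> Hom \<A> Z X. \<exists>\<pi>' \<in> Hom \<A> Z Y.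
        \<pi> \<cdot> \<iota> = ident \<A> X \<and> \<pi>' \<cdot> \<iota>' = ident \<A> Y \<and>
        \<pi> \<cdot> \<iota>' = zero_arr \<A> Y X \<and> \<pi>' \<cdot> \<iota> = zero_arr \<A> X Y \<and>
        (\<iota> \<cdot> \<pi>) \<boxplus> (\<iota>' \<cdot> \<pi>') = ident \<A> Z"
    and image_factorization: "f \<in> arrows \<A> \<Longrightarrow>
      \<exists>k p j c. is_kernel \<A> k f \<and> is_cokernel \<A> c f \<and> is_cokernel \<A> p k \<and> is_kernel \<A> j c \<and>
        tgt \<A> p = src \<A> j \<and> j \<cdot> p = f"

definition subobject_rel :: "('o, 'm) additive_data \<Rightarrow> 'o \<Rightarrow> ('m \<times> 'm) set" where
  "subobject_rel \<A> X = {(i, i'). monic \<A> i \<and> tgt \<A> i = X \<and> monic \<A> i' \<and> tgt \<A> i' = X \<and>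
     (\<exists>h \<in> Hom \<A> (src \<A> i) (src \<A> i'). iso_arr \<A> h \<and> i = i' \<cdot>\<^bsub>\<A>\<^esub> h)}"

definition subobjects :: "('o, 'm) additive_data \<Rightarrow> 'o \<Rightarrow> 'm set set" where
  "subobjects \<A> X = {i. monic \<A> i \<and> tgt \<A> i = X} // subobject_rel \<A> X"

definition quotient_rel :: "('o, 'm) additive_data \<Rightarrow> 'o \<Rightarrow> ('m \<times> 'm) set" where
  "quotient_rel \<A> X = {(p, p'). epic \<A> p \<and> src \<A> p = X \<and> epic \<A> p' \<and> src \<A> p' = X \<and>
     (\<exists>h \<in> Hom \<A> (tgt \<A> p) (tgt \<A> p'). iso_arr \<A> h \<and> p' = h \<cdot>\<^bsub>\<A>\<^esub> p)}"

definition quotient_objects :: "('o, 'm) additive_data \<Rightarrow> 'o \<Rightarrow> 'm set set" where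
  "quotient_objects \<A> X = {p. epic \<A> p \<and> src \<A> p = X} // quotient_rel \<A> X"

definition sub_le :: "('o, 'm) additive_data \<Rightarrow> 'm set \<Rightarrow> 'm set \<Rightarrow> bool" where
  "sub_le \<A> U V \<longleftrightarrow> (\<exists>i \<in> U. \<exists>j \<in> V. \<exists>h \<in> Hom \<A> (src \<A> i) (src \<A> j). i = j \<cdot>\<^bsub>\<A>\<^esub> h)"

definition zero_sub :: "('o, 'm) additive_data \<Rightarrow> 'o \<Rightarrow> 'm set" where
  "zero_sub \<A> X = {i. monic \<A> i \<and> tgt \<A> i = X \<and> zero_object \<A> (src \<A> i)}"

definition full_sub :: "('o, 'm) additive_data \<Rightarrow> 'o \<Rightarrow> 'm set" where
  "full_sub \<A> X = subobject_rel \<A> X `` {ident \<A> X}"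

text \<open>The quotient object \<open>X/U\<close> of a subobject \<open>U\<close> of \<open>X\<close>: the class of all its cokernels.\<close>

definition quotient_by :: "('o, 'm) additive_data \<Rightarrow> 'm set \<Rightarrow> 'm set" where
  "quotient_by \<A> U = {p. \<exists>i \<in> U. is_cokernel \<A> p i}"

definition artinian :: "('o, 'm) additive_data \<Rightarrow> 'o \<Rightarrow> bool" where
  "artinian \<A> X \<longleftrightarrow> (\<forall>U :: nat \<Rightarrow> 'm set.
     (\<forall>k. U k \<in> subobjects \<A> X \<and> sub_le \<A> (U (Suc k)) (U k)) \<longrightarrow> (\<exists>N. \<forall>k \<ge> N. U k = U N))"

definition noetherian :: "('o, 'm) additive_data \<Rightarrow> 'o \<Rightarrow> bool" where
  "noetherian \<A> X \<longleftrightarrow> (\<forall>U :: nat \<Rightarrow> 'm set.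
     (\<forall>k. U k \<in> subobjects \<A> X \<and> sub_le \<A> (U k) (U (Suc k))) \<longrightarrow> (\<exists>N. \<forall>k \<ge> N. U k = U N))"

definition finite_length :: "('o, 'm) additive_data \<Rightarrow> bool" where
  "finite_length \<A> \<longleftrightarrow> (\<forall>X \<in> objects \<A>. artinian \<A> X \<and> noetherian \<A> X)"

definition simple_object :: "('o, 'm) additive_data \<Rightarrow> 'o \<Rightarrow> bool" where
  "simple_object \<A> S \<longleftrightarrow> S \<in> objects \<A> \<and> \<not> zero_object \<A> S \<and>
     (\<forall>U \<in> subobjects \<A> S. U = zero_sub \<A> S \<or> U = full_sub \<A> S)"

text \<open>
  For subobjects \<open>U \<subseteq> V\<close> the object \<open>V/U\<close> is only determined up to isomorphism, hence a predicate:
  \<open>T\<close> is the target of some cokernel of the inclusion of \<open>U\<close> into \<open>V\<close>.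
\<close>

definition is_factor :: "('o, 'm) additive_data \<Rightarrow> 'm set \<Rightarrow> 'm set \<Rightarrow> 'o \<Rightarrow> bool" where
  "is_factor \<A> U V T \<longleftrightarrow> (\<exists>i \<in> U. \<exists>j \<in> V. \<exists>h \<in> Hom \<A> (src \<A> i) (src \<A> j).
     i = j \<cdot>\<^bsub>\<A>\<^esub> h \<and> (\<exists>p. is_cokernel \<A> p h \<and> tgt \<A> p = T))"

text \<open>
  \<open>0 = B 0 \<subset> \<dots> \<subset> B n = X\<close> with chosen factors \<open>T k = B k / B (k - 1)\<close> for \<open>1 \<le> k \<le> n\<close>. The inclusions
  are part of \<open>is_factor\<close>; they are strict because the factors are nonzero. Values of \<open>B\<close> and \<open>T\<close>
  at other indices are irrelevant.
\<close>

definition composition_series ::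
  "('o, 'm) additive_data \<Rightarrow> 'o \<Rightarrow> nat \<Rightarrow> (nat \<Rightarrow> 'm set) \<Rightarrow> (nat \<Rightarrow> 'o) \<Rightarrow> bool" where
  "composition_series \<A> X n B T \<longleftrightarrow>
     (\<forall>k \<le> n. B k \<in> subobjects \<A> X) \<and> B 0 = zero_sub \<A> X \<and> B n = full_sub \<A> X \<and>
     (\<forall>k \<in> {1..n}. is_factor \<A> (B (k - 1)) (B k) (T k) \<and> simple_object \<A> (T k))"

text \<open>\<open>(S i)\<^sub>i\<^sub>\<in>\<^sub>I\<close> lists, without repetition, the pairwise nonisomorphic factors of a composition
  series of \<open>X\<close>; in particular \<open>I\<close> is finite.\<close>

definition nonisomorphic_simple_factors ::
  "('o, 'm) additive_data \<Rightarrow> 'o \<Rightarrow> 'i set \<Rightarrow> ('i \<Rightarrow> 'o) \<Rightarrow> bool" where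
  "nonisomorphic_simple_factors \<A> X I S \<longleftrightarrow>
     (\<exists>n A R. composition_series \<A> X n A R \<and>
        (\<forall>k l. 1 \<le> k \<and> k < l \<and> l \<le> n \<longrightarrow> \<not> iso_obj \<A> (R k) (R l)) \<and>
        (\<exists>\<psi>. bij_betw \<psi> I {1..n} \<and> (\<forall>i \<in> I. S i = R (\<psi> i))))"

text \<open>\<open>\<phi>\<close> matches the family \<open>(S i)\<^sub>i\<^sub>\<in>\<^sub>K\<close> with the list \<open>T 1, \<dots>, T n\<close> up to isomorphism and order.\<close>

definition factor_matching :: "('o, 'm) additive_data \<Rightarrow> 'i set \<Rightarrow> ('i \<Rightarrow> 'o) \<Rightarrow>
    nat \<Rightarrow> (nat \<Rightarrow> 'o) \<Rightarrow> ('i \<Rightarrow> nat) \<Rightarrow> bool" where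
  "factor_matching \<A> K S n T \<phi> \<longleftrightarrow>
     bij_betw \<phi> K {1..n} \<and> (\<forall>i \<in> K. iso_obj \<A> (S i) (T (\<phi> i)))"

definition factor_le ::
  "('o, 'm) additive_data \<Rightarrow> 'o \<Rightarrow> 'i set \<Rightarrow> ('i \<Rightarrow> 'o) \<Rightarrow> 'i \<Rightarrow> 'i \<Rightarrow> bool" where
  "factor_le \<A> X I S i j \<longleftrightarrow> i \<in> I \<and> j \<in> I \<and>
     (\<forall>n B T \<phi>. composition_series \<A> X n B T \<and> factor_matching \<A> I S n T \<phi> \<longrightarrow> \<phi> i \<le> \<phi> j)"

definition q_set ::
  "('o, 'm) additive_data \<Rightarrow> 'o \<Rightarrow> 'i set \<Rightarrow> ('i \<Rightarrow> 'o) \<Rightarrow> 'i set \<Rightarrow> bool" where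
  "q_set \<A> X I S K \<longleftrightarrow> K \<subseteq> I \<and> (\<forall>i \<in> I. \<forall>j \<in> K. factor_le \<A> X I S j i \<longrightarrow> i \<in> K)"

definition quotient_has_factors ::
  "('o, 'm) additive_data \<Rightarrow> 'm set \<Rightarrow> ('i \<Rightarrow> 'o) \<Rightarrow> 'i set \<Rightarrow> bool" where
  "quotient_has_factors \<A> Q S K \<longleftrightarrow>
     (\<forall>\<pi> \<in> Q. \<forall>n B T. composition_series \<A> (tgt \<A> \<pi>) n B T \<longrightarrow> (\<exists>\<phi>. factor_matching \<A> K S n T \<phi>))"

end

theory Submission
  imports Defs "HOL-Library.Multiset"
begin

text \<open>
  Write \<open>J(Y)\<close> for the set of isomorphism classes of the composition factors of an object \<open>Y\<close>.
  Composition factors are additive along short exact sequences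
  (\<open>has_series_append\<close>, \<open>has_series_split\<close>), which also yields the Jordan--Hoelder theorem
  (\<open>jordan_hoelder\<close>). So, if the simple factors of \<open>X\<close> are pairwise nonisomorphic, \<open>J(X)\<close> is
  the disjoint union of \<open>J(U)\<close> and \<open>J(X/U)\<close> for every subobject \<open>U\<close> of \<open>X\<close>.

  This disjointness carries the whole argument, through one observation: for subobjects \<open>U\<close>, \<open>V\<close>
  the image of \<open>U\<close> in \<open>X/V\<close> has its factors in \<open>J(U) \<inter> J(X/V)\<close>. Two consequences follow. First, if
  \<open>J(X/V) \<subseteq> J(X/U)\<close>, the image has no factors and is zero, so \<open>U\<close> is contained in \<open>V\<close>. Hence a quotient of
  \<open>X\<close> is determined by its factors (\<open>quotient_unique\<close>). Secondly, the kernel and the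
  cokernel of \<open>U \<rightarrow> X/V\<close> are \<open>U \<inter> V\<close> and \<open>X/(U + V)\<close>, and counting factors gives
  \<open>J(U \<inter> V) = J(U) \<inter> J(V)\<close> and \<open>J(U + V) = J(U) \<union> J(V)\<close>. Thus the sets \<open>J(U)\<close> form a
  ring of sets (\<open>ex_intersection\<close>, \<open>ex_sum\<close>).

  The order on \<open>I\<close> is exactly the one that belongs to this ring of sets: \<open>i \<preceq> j\<close> if and only if each
  \<open>J(U)\<close> that contains \<open>S j\<close> contains \<open>S i\<close> (\<open>factor_le_iff\<close>), because the terms of composition
  series are subobjects, and every subobject is a term of a composition series. As in Birkhoff's
  theorem on finite distributive lattices, the lower sets of that order are precisely the members of the ring
  (\<open>lower_set_in_ring_of_sets\<close>). The q-sets are the complements of lower sets, and so they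
  are precisely the index sets of the \<open>J(X/U)\<close> (\<open>q_set_iff\<close>).
\<close>

section \<open>Arrows of an abelian category\<close>

text \<open>
  Passing to the opposite category exchanges monic with epic and kernels with cokernels, so that of each
  pair of dual statements only one needs an argument.
\<close>

definition opposite :: "('o, 'm) additive_data \<Rightarrow> ('o, 'm) additive_data" where
  "opposite \<A> = \<lparr>objects = objects \<A>, arrows = arrows \<A>, src = tgt \<A>, tgt = src \<A>,
     ident = ident \<A>, arr_comp = (\<lambda>f g. g \<cdot>\<^bsub>\<A>\<^esub> f), arr_add = arr_add \<A>,
     zero_arr = (\<lambda>X Y. zero_arr \<A> Y X)\<rparr>"

lemma opposite_simps [simp]:
  "objects (opposite \<A>) = objects \<A>" "arrows (opposite \<A>) = arrows \<A>"
  "src (opposite \<A>) = tgt \<A>" "tgt (opposite \<A>) = src \<A>" "ident (opposite \<A>) = ident \<A>"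
  "arr_comp (opposite \<A>) f g = g \<cdot>\<^bsub>\<A>\<^esub> f" "arr_add (opposite \<A>) = arr_add \<A>"
  "zero_arr (opposite \<A>) X Y = zero_arr \<A> Y X"
  by (simp_all add: opposite_def)

lemma Hom_opposite [simp]: "Hom (opposite \<A>) X Y = Hom \<A> Y X"
  by (auto simp: Hom_def)

lemma monic_opposite [simp]: "monic (opposite \<A>) f = epic \<A> f"
  by (simp add: monic_def epic_def)

lemma epic_opposite [simp]: "epic (opposite \<A>) f = monic \<A> f"
  by (simp add: monic_def epic_def)

lemma iso_arr_opposite [simp]: "iso_arr (opposite \<A>) f = iso_arr \<A> f"
  by (auto simp: iso_arr_def)

lemma is_kernel_opposite [simp]: "is_kernel (opposite \<A>) k f = is_cokernel \<A> k f"
  by (simp add: is_kernel_def is_cokernel_def)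

lemma is_cokernel_opposite [simp]: "is_cokernel (opposite \<A>) k f = is_kernel \<A> k f"
  by (simp add: is_kernel_def is_cokernel_def)

lemma zero_object_opposite [simp]: "zero_object (opposite \<A>) Z = zero_object \<A> Z"
  by (auto simp: zero_object_def)

context abelian_category
begin

lemma Hom_objects: "f \<in> Hom \<A> X Y \<Longrightarrow> X \<in> objects \<A>" "f \<in> Hom \<A> X Y \<Longrightarrow> Y \<in> objects \<A>"
  using src_object tgt_object by (auto simp: Hom_def)

lemma Hom_arrow: "f \<in> Hom \<A> X Y \<Longrightarrow> f \<in> arrows \<A>" "f \<in> Hom \<A> X Y \<Longrightarrow> src \<A> f = X"
  "f \<in> Hom \<A> X Y \<Longrightarrow> tgt \<A> f = Y"
  by (auto simp: Hom_def)

lemma zero_Hom: "X \<in> objects \<A> \<Longrightarrow> Y \<in> objects \<A> \<Longrightarrow> zero_arr \<A> X Y \<in> Hom \<A> X Y"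
  using monoid.one_closed[OF comm_monoid.axioms(1)[OF comm_group.axioms(1)[OF Hom_group]]]
  by simp

lemma add_self_zero:
  assumes "f \<in> Hom \<A> X Y" and "f \<boxplus> f = f"
  shows "f = zero_arr \<A> X Y"
proof -
  let ?G = "\<lparr>carrier = Hom \<A> X Y, monoid.mult = arr_add \<A>, one = zero_arr \<A> X Y\<rparr>"
  have "group ?G"
    using Hom_group Hom_objects assms(1) comm_group.axioms(2) by blast
  from group.l_cancel_one[OF this, of f f] assms show ?thesis
    by simp
qed

lemma comp_zero:
  assumes "W \<in> objects \<A>" and g: "g \<in> Hom \<A> X Y"
  shows "g \<cdot> zero_arr \<A> W X = zero_arr \<A> W Y"
proof -
  let ?z = "zero_arr \<A> W X"
  have z: "?z \<in> Hom \<A> W X"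
    using assms zero_Hom Hom_objects by blast
  interpret G: comm_group "\<lparr>carrier = Hom \<A> W X, monoid.mult = arr_add \<A>, one = ?z\<rparr>"
    using Hom_group Hom_objects z by blast
  have "?z \<boxplus> ?z = ?z"
    using G.l_one[of ?z] z by simp
  then have "(g \<cdot> ?z) \<boxplus> (g \<cdot> ?z) = g \<cdot> ?z"
    using comp_add_right[OF z z g] by simp
  then show ?thesis
    using add_self_zero comp_Hom[OF z g] by blast
qed

lemma opposite_abelian: "abelian_category (opposite \<A>)"
proof (intro abelian_category.intro category_laws.intro abelian_category_axioms.intro, goal_cases)
  case (8 X Y)
  then show ?case
    using Hom_group by simp
next
  case (9 f X Y f' g Z)
  then show ?case
    using comp_add_left by simp
next
  case (10 f X Y g g' Z)
  then show ?case
    using comp_add_right by simp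
next
  case 11
  then show ?case
    using ex_zero_object by simp
next
  case (12 X Y)
  then show ?case
    using ex_direct_sum[of X Y] by simp metis
next
  case (13 f)
  then obtain k p j c where "is_kernel \<A> k f" "is_cokernel \<A> c f" "is_cokernel \<A> p k"
      "is_kernel \<A> j c" "tgt \<A> p = src \<A> j" "j \<cdot> p = f"
    using image_factorization[of f] by auto
  then have "is_kernel (opposite \<A>) c f \<and> is_cokernel (opposite \<A>) k f \<and>
      is_cokernel (opposite \<A>) j c \<and> is_kernel (opposite \<A>) p k \<and>
      tgt (opposite \<A>) j = src (opposite \<A>) p \<and> p \<cdot>\<^bsub>opposite \<A>\<^esub> j = f"
    by simp
  then show ?case
    by blast
qed (auto simp: src_object tgt_object ident_Hom comp_Hom ident_left ident_right comp_assoc)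

lemma zero_comp:
  assumes "W \<in> objects \<A>" and "g \<in> Hom \<A> X Y"
  shows "zero_arr \<A> Y W \<cdot> g = zero_arr \<A> X W"
  using abelian_category.comp_zero[OF opposite_abelian, of W g Y X] assms by simp

text \<open>
  In an additive category it suffices to test cancellation against zero: apply the test to the
  difference of two arrows.
\<close>

lemma monicI:
  assumes i: "i \<in> Hom \<A> X Y"
    and z: "\<And>W g. g \<in> Hom \<A> W X \<Longrightarrow> i \<cdot> g = zero_arr \<A> W Y \<Longrightarrow> g = zero_arr \<A> W X"
  shows "monic \<A> i"
  unfolding monic_def
proof (intro conjI ballI impI)
  show "i \<in> arrows \<A>"
    using i Hom_arrow by blast
next
  fix W f g
  assume W: "W \<in> objects \<A>" and f: "f \<in> Hom \<A> W (src \<A> i)" and g: "g \<in> Hom \<A> W (src \<A> i)"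
    and eq: "i \<cdot> f = i \<cdot> g"
  have X: "src \<A> i = X" "X \<in> objects \<A>"
    using i Hom_arrow Hom_objects by blast+
  let ?G = "\<lparr>carrier = Hom \<A> W X, monoid.mult = arr_add \<A>, one = zero_arr \<A> W X\<rparr>"
  interpret G: comm_group ?G
    using Hom_group W X by blast
  define m where "m = inv\<^bsub>?G\<^esub> g"
  have m: "m \<in> Hom \<A> W X"
    using G.inv_closed[of g] g X by (simp add: m_def)
  have gm: "g \<boxplus> m = zero_arr \<A> W X"
    using G.r_inv[of g] g X by (simp add: m_def)
  have "i \<cdot> (f \<boxplus> m) = i \<cdot> (g \<boxplus> m)"
    using comp_add_right[OF _ m i] f g eq X by simp
  also have "\<dots> = zero_arr \<A> W Y"
    using comp_zero[OF W i] gm by simp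
  finally have "f \<boxplus> m = zero_arr \<A> W X"
    using z[of "f \<boxplus> m" W] G.m_closed[of f m] f m X by simp
  with gm show "f = g"
    using G.right_cancel[of m f g] f g m X by simp
qed

lemma epicI:
  assumes "p \<in> Hom \<A> X Y"
    and "\<And>W g. g \<in> Hom \<A> Y W \<Longrightarrow> g \<cdot> p = zero_arr \<A> X W \<Longrightarrow> g = zero_arr \<A> Y W"
  shows "epic \<A> p"
  using abelian_category.monicI[OF opposite_abelian, of p Y X] assms by simp

lemma monicD:
  assumes "monic \<A> i" "i \<in> Hom \<A> X Y" "f \<in> Hom \<A> W X" "g \<in> Hom \<A> W X" "i \<cdot> f = i \<cdot> g"
  shows "f = g"
  using assms Hom_objects(1)[OF assms(3)] unfolding monic_def Hom_def by blast

lemma epicD: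
  assumes "epic \<A> p" "p \<in> Hom \<A> X Y" "f \<in> Hom \<A> Y W" "g \<in> Hom \<A> Y W" "f \<cdot> p = g \<cdot> p"
  shows "f = g"
  using assms Hom_objects(2)[OF assms(3)] unfolding epic_def Hom_def by blast

lemma monic_zeroD:
  assumes "monic \<A> i" "i \<in> Hom \<A> X Y" "f \<in> Hom \<A> W X" "i \<cdot> f = zero_arr \<A> W Y"
  shows "f = zero_arr \<A> W X"
  using monicD[OF assms(1-3) zero_Hom] comp_zero[OF _ assms(2)] assms(4) Hom_objects assms
  by metis

lemma epic_zeroD:
  assumes "epic \<A> p" "p \<in> Hom \<A> X Y" "f \<in> Hom \<A> Y W" "f \<cdot> p = zero_arr \<A> X W"
  shows "f = zero_arr \<A> Y W"
  using epicD[OF assms(1-3) zero_Hom] zero_comp[OF _ assms(2)] assms(4) Hom_objects assms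
  by metis

lemma monic_comp:
  assumes i: "monic \<A> i" "i \<in> Hom \<A> X Y" and j: "monic \<A> j" "j \<in> Hom \<A> Y Z"
  shows "monic \<A> (j \<cdot> i)"
proof (rule monicI[OF comp_Hom[OF i(2) j(2)]])
  fix W g
  assume g: "g \<in> Hom \<A> W X" and "(j \<cdot> i) \<cdot> g = zero_arr \<A> W Z"
  then have "j \<cdot> (i \<cdot> g) = zero_arr \<A> W Z"
    using comp_assoc i j by simp
  then show "g = zero_arr \<A> W X"
    using monic_zeroD i j g comp_Hom by metis
qed

lemma epic_comp:
  assumes "epic \<A> p" "p \<in> Hom \<A> X Y" "epic \<A> q" "q \<in> Hom \<A> Y Z"
  shows "epic \<A> (q \<cdot> p)"
  using abelian_category.monic_comp[OF opposite_abelian, of q Z Y p X] assms by simp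

lemma monic_cancel:
  assumes "monic \<A> (j \<cdot> i)" and i: "i \<in> Hom \<A> X Y" and j: "j \<in> Hom \<A> Y Z"
  shows "monic \<A> i"
proof (rule monicI[OF i])
  fix W g
  assume g: "g \<in> Hom \<A> W X" and "i \<cdot> g = zero_arr \<A> W Y"
  then have "(j \<cdot> i) \<cdot> g = zero_arr \<A> W Z"
    using comp_assoc[OF g i j] comp_zero[OF _ j] Hom_objects by simp
  then show "g = zero_arr \<A> W X"
    using monic_zeroD[OF assms(1) comp_Hom[OF i j] g] by simp
qed

lemma epic_cancel:
  assumes "epic \<A> (q \<cdot> p)" "p \<in> Hom \<A> X Y" "q \<in> Hom \<A> Y Z"
  shows "epic \<A> q"
  using abelian_category.monic_cancel[OF opposite_abelian, of p q Z Y X] assms by simp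

lemma iso_arrI:
  assumes "f \<in> Hom \<A> X Y" "g \<in> Hom \<A> Y X" "g \<cdot> f = ident \<A> X" "f \<cdot> g = ident \<A> Y"
  shows "iso_arr \<A> f"
  using assms unfolding iso_arr_def Hom_def by auto

lemma iso_arrE:
  assumes "iso_arr \<A> f" "f \<in> Hom \<A> X Y"
  obtains g where "g \<in> Hom \<A> Y X" "g \<cdot> f = ident \<A> X" "f \<cdot> g = ident \<A> Y" "iso_arr \<A> g"
proof -
  obtain g where "g \<in> Hom \<A> Y X" "g \<cdot> f = ident \<A> X" "f \<cdot> g = ident \<A> Y"
    using assms unfolding iso_arr_def Hom_def by auto
  then show thesis
    using that iso_arrI assms(2) by blast
qed

lemma ident_iso: "X \<in> objects \<A> \<Longrightarrow> iso_arr \<A> (ident \<A> X)"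
  using iso_arrI[OF ident_Hom ident_Hom] ident_left ident_Hom by metis

lemma ident_monic: "X \<in> objects \<A> \<Longrightarrow> monic \<A> (ident \<A> X)"
  using monicI[OF ident_Hom] ident_left by metis

lemma iso_monic:
  assumes "iso_arr \<A> f" and f: "f \<in> Hom \<A> X Y"
  shows "monic \<A> f"
proof -
  obtain g where "g \<in> Hom \<A> Y X" "g \<cdot> f = ident \<A> X"
    using iso_arrE[OF assms] by blast
  then show ?thesis
    using monic_cancel[of g f X Y X] f ident_monic Hom_objects(1)[OF f] by simp
qed

lemma iso_epic: "iso_arr \<A> f \<Longrightarrow> f \<in> Hom \<A> X Y \<Longrightarrow> epic \<A> f"
  using abelian_category.iso_monic[OF opposite_abelian, of f Y X] by simp

lemma iso_comp:
  assumes f: "iso_arr \<A> f" "f \<in> Hom \<A> X Y" and g: "iso_arr \<A> g" "g \<in> Hom \<A> Y Z"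
  shows "iso_arr \<A> (g \<cdot> f)"
proof -
  obtain f' where f': "f' \<in> Hom \<A> Y X" "f' \<cdot> f = ident \<A> X" "f \<cdot> f' = ident \<A> Y"
    using iso_arrE[OF f] .
  obtain g' where g': "g' \<in> Hom \<A> Z Y" "g' \<cdot> g = ident \<A> Y" "g \<cdot> g' = ident \<A> Z"
    using iso_arrE[OF g] .
  have "(f' \<cdot> g') \<cdot> (g \<cdot> f) = f' \<cdot> ((g' \<cdot> g) \<cdot> f)"
    using comp_assoc[OF comp_Hom[OF f(2) g(2)] g'(1) f'(1)] comp_assoc[OF f(2) g(2) g'(1)] by simp
  moreover have "(g \<cdot> f) \<cdot> (f' \<cdot> g') = g \<cdot> ((f \<cdot> f') \<cdot> g')"
    using comp_assoc[OF comp_Hom[OF g'(1) f'(1)] f(2) g(2)] comp_assoc[OF g'(1) f'(1) f(2)] by simp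
  ultimately show ?thesis
    using iso_arrI[OF comp_Hom[OF f(2) g(2)] comp_Hom[OF g'(1) f'(1)]] f' g'
      ident_left[OF f(2)] ident_left[OF g'(1)] by simp
qed

lemma kernel_Hom: "is_kernel \<A> k f \<Longrightarrow> f \<in> Hom \<A> X Y \<Longrightarrow> k \<in> Hom \<A> (src \<A> k) X"
  by (auto simp: is_kernel_def Hom_def)

lemma kernel_zero: "is_kernel \<A> k f \<Longrightarrow> k \<in> Hom \<A> W X \<Longrightarrow> f \<in> Hom \<A> X Y \<Longrightarrow> f \<cdot> k = zero_arr \<A> W Y"
  by (auto simp: is_kernel_def Hom_def)

lemma kernel_lift:
  assumes "is_kernel \<A> k f" "k \<in> Hom \<A> K X" "f \<in> Hom \<A> X Y" "g \<in> Hom \<A> W X"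
    "f \<cdot> g = zero_arr \<A> W Y"
  obtains h where "h \<in> Hom \<A> W K" "k \<cdot> h = g"
proof -
  have "g \<in> arrows \<A> \<and> tgt \<A> g = src \<A> f \<and> f \<cdot> g = zero_arr \<A> (src \<A> g) (tgt \<A> f)"
    using assms by (simp add: Hom_def)
  then have "\<exists>h. h \<in> Hom \<A> (src \<A> g) (src \<A> k) \<and> k \<cdot> h = g"
    using assms(1) unfolding is_kernel_def by blast
  then show thesis
    using that assms(2,4) by (auto simp: Hom_def)
qed

lemma kernel_monic:
  assumes k: "is_kernel \<A> k f"
  shows "monic \<A> k"
  unfolding monic_def
proof (intro conjI ballI impI)
  show "k \<in> arrows \<A>"
    using k by (simp add: is_kernel_def)
next
  fix W g h
  assume W: "W \<in> objects \<A>" and g: "g \<in> Hom \<A> W (src \<A> k)" and h: "h \<in> Hom \<A> W (src \<A> k)"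
    and eq: "k \<cdot> g = k \<cdot> h"
  have f: "f \<in> Hom \<A> (src \<A> f) (tgt \<A> f)" and kH: "k \<in> Hom \<A> (src \<A> k) (src \<A> f)"
    using k by (auto simp: is_kernel_def Hom_def)
  have kg: "k \<cdot> g \<in> Hom \<A> W (src \<A> f)"
    using comp_Hom g kH by blast
  have "f \<cdot> (k \<cdot> g) = zero_arr \<A> W (tgt \<A> f)"
    using comp_assoc[OF g kH f] kernel_zero[OF k kH f] zero_comp[OF Hom_objects(2)[OF f] g] by simp
  moreover have "k \<cdot> g \<in> arrows \<A>" "src \<A> (k \<cdot> g) = W" "tgt \<A> (k \<cdot> g) = src \<A> f"
    using kg Hom_arrow by blast+
  moreover have "\<forall>g \<in> arrows \<A>. tgt \<A> g = src \<A> f \<and> f \<cdot> g = zero_arr \<A> (src \<A> g) (tgt \<A> f) \<longrightarrow>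
      (\<exists>!h. h \<in> Hom \<A> (src \<A> g) (src \<A> k) \<and> k \<cdot> h = g)"
    using k by (simp add: is_kernel_def)
  ultimately have "\<exists>!x. x \<in> Hom \<A> W (src \<A> k) \<and> k \<cdot> x = k \<cdot> g"
    by metis
  then show "g = h"
    using g h eq by metis
qed

lemma is_kernelI:
  assumes k: "k \<in> Hom \<A> K X" "monic \<A> k" and f: "f \<in> Hom \<A> X Y" and z: "f \<cdot> k = zero_arr \<A> K Y"
    and u: "\<And>W g. g \<in> Hom \<A> W X \<Longrightarrow> f \<cdot> g = zero_arr \<A> W Y \<Longrightarrow> \<exists>h \<in> Hom \<A> W K. k \<cdot> h = g"
  shows "is_kernel \<A> k f"
  unfolding is_kernel_def
proof (intro conjI ballI impI)
  fix g
  assume g: "g \<in> arrows \<A>"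
    "tgt \<A> g = src \<A> f \<and> f \<cdot> g = zero_arr \<A> (src \<A> g) (tgt \<A> f)"
  then have "\<exists>h \<in> Hom \<A> (src \<A> g) K. k \<cdot> h = g"
    using u[of g "src \<A> g"] f by (simp add: Hom_def)
  moreover have "src \<A> k = K"
    using k Hom_arrow by blast
  ultimately show "\<exists>!h. h \<in> Hom \<A> (src \<A> g) (src \<A> k) \<and> k \<cdot> h = g"
    using monicD[OF k(2,1)] by metis
qed (use k f z in \<open>auto simp: Hom_def\<close>)

lemma ex_kernel: "f \<in> Hom \<A> X Y \<Longrightarrow> \<exists>k K. is_kernel \<A> k f \<and> k \<in> Hom \<A> K X"
  using image_factorization[of f] kernel_Hom Hom_arrow(1) by metis

lemma cokernel_Hom: "is_cokernel \<A> c f \<Longrightarrow> f \<in> Hom \<A> X Y \<Longrightarrow> c \<in> Hom \<A> Y (tgt \<A> c)"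
  by (auto simp: is_cokernel_def Hom_def)

lemma cokernel_zero:
  "is_cokernel \<A> c f \<Longrightarrow> c \<in> Hom \<A> Y Z \<Longrightarrow> f \<in> Hom \<A> X Y \<Longrightarrow> c \<cdot> f = zero_arr \<A> X Z"
  by (auto simp: is_cokernel_def Hom_def)

lemma cokernel_lift:
  assumes "is_cokernel \<A> c f" "c \<in> Hom \<A> Y C" "f \<in> Hom \<A> X Y" "g \<in> Hom \<A> Y W"
    "g \<cdot> f = zero_arr \<A> X W"
  obtains h where "h \<in> Hom \<A> C W" "h \<cdot> c = g"
  using abelian_category.kernel_lift[OF opposite_abelian, of c f C Y X g W] assms by auto

lemma cokernel_epic: "is_cokernel \<A> c f \<Longrightarrow> epic \<A> c"
  using abelian_category.kernel_monic[OF opposite_abelian, of c f] by simp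

lemma is_cokernelI:
  assumes "c \<in> Hom \<A> Y C" "epic \<A> c" "f \<in> Hom \<A> X Y" "c \<cdot> f = zero_arr \<A> X C"
    and "\<And>W g. g \<in> Hom \<A> Y W \<Longrightarrow> g \<cdot> f = zero_arr \<A> X W \<Longrightarrow> \<exists>h \<in> Hom \<A> C W. h \<cdot> c = g"
  shows "is_cokernel \<A> c f"
  using abelian_category.is_kernelI[OF opposite_abelian, of c C Y f X] assms by simp

lemma ex_cokernel: "f \<in> Hom \<A> X Y \<Longrightarrow> \<exists>c C. is_cokernel \<A> c f \<and> c \<in> Hom \<A> Y C"
  using image_factorization[of f] cokernel_Hom Hom_arrow(1) by metis

text \<open>
  The image factorization \<open>i = j \<cdot> p\<close> of a monic arrow has \<open>p\<close> the cokernel of the zero arrow,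
  hence invertible, and \<open>j\<close> the kernel of a cokernel of \<open>i\<close>.
\<close>

lemma monic_is_kernel:
  assumes i: "monic \<A> i" "i \<in> Hom \<A> X Y" and c: "is_cokernel \<A> c i" "c \<in> Hom \<A> Y C"
  shows "is_kernel \<A> i c"
proof (rule is_kernelI[OF i(2,1) c(2) cokernel_zero[OF c i(2)]])
  fix W g
  assume g: "g \<in> Hom \<A> W Y" "c \<cdot> g = zero_arr \<A> W C"
  obtain k p j c' where k: "is_kernel \<A> k i" and c': "is_cokernel \<A> c' i" and p: "is_cokernel \<A> p k"
    and j: "is_kernel \<A> j c'" and pj: "tgt \<A> p = src \<A> j" "j \<cdot> p = i"
    using image_factorization[of i] i(2) Hom_arrow(1) by metis
  define J where "J = src \<A> j"
  have kH: "k \<in> Hom \<A> (src \<A> k) X"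
    using kernel_Hom[OF k i(2)] .
  have pH: "p \<in> Hom \<A> X J"
    using cokernel_Hom[OF p kH] pj by (simp add: J_def)
  have c'H: "c' \<in> Hom \<A> Y (tgt \<A> c')"
    using cokernel_Hom[OF c' i(2)] .
  have jH: "j \<in> Hom \<A> J Y"
    using kernel_Hom[OF j c'H] by (simp add: J_def)
  have X: "X \<in> objects \<A>" and K: "src \<A> k \<in> objects \<A>" and J: "J \<in> objects \<A>"
    using Hom_objects kH pH by blast+
  have "k = zero_arr \<A> (src \<A> k) X"
    using monic_zeroD[OF i kH] kernel_zero[OF k kH i(2)] by simp
  then have "ident \<A> X \<cdot> k = zero_arr \<A> (src \<A> k) X"
    using ident_left[OF kH] by simp
  then obtain h where h: "h \<in> Hom \<A> J X" "h \<cdot> p = ident \<A> X"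
    using cokernel_lift[OF p pH kH ident_Hom[OF X]] by blast
  have "(p \<cdot> h) \<cdot> p = ident \<A> J \<cdot> p"
    using comp_assoc[OF pH h(1) pH] h ident_left[OF pH] ident_right[OF pH] by simp
  then have ph: "p \<cdot> h = ident \<A> J"
    using epicD[OF cokernel_epic[OF p] pH] comp_Hom h(1) pH ident_Hom[OF J] by blast
  \<comment> \<open>The cokernel \<open>c'\<close> of the factorization need not be \<open>c\<close>, but it factors through \<open>c\<close>.\<close>
  obtain d where d: "d \<in> Hom \<A> C (tgt \<A> c')" "d \<cdot> c = c'"
    using cokernel_lift[OF c i(2) c'H cokernel_zero[OF c' c'H i(2)]] .
  have "c' \<cdot> g = zero_arr \<A> W (tgt \<A> c')"
    using comp_assoc[OF g(1) c(2) d(1)] d comp_zero[OF _ d(1)] g Hom_objects by simp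
  then obtain x where x: "x \<in> Hom \<A> W J" "j \<cdot> x = g"
    using kernel_lift[OF j jH c'H g(1)] by blast
  have "i \<cdot> (h \<cdot> x) = j \<cdot> ((p \<cdot> h) \<cdot> x)"
    using comp_assoc[OF comp_Hom[OF x(1) h(1)] pH jH] comp_assoc[OF x(1) h(1) pH] pj(2) by simp
  then show "\<exists>h \<in> Hom \<A> W X. i \<cdot> h = g"
    using x ph comp_Hom[OF x(1) h(1)] ident_left[OF x(1)] by auto
qed

lemma epic_is_cokernel:
  assumes "epic \<A> p" "p \<in> Hom \<A> X Y" "is_kernel \<A> k p" "k \<in> Hom \<A> K X"
  shows "is_cokernel \<A> p k"
  using abelian_category.monic_is_kernel[OF opposite_abelian, of p Y X k K] assms by simp

lemma monic_epic_iso: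
  assumes m: "monic \<A> f" and e: "epic \<A> f" and f: "f \<in> Hom \<A> X Y"
  shows "iso_arr \<A> f"
proof -
  obtain c C where c: "is_cokernel \<A> c f" "c \<in> Hom \<A> Y C"
    using ex_cokernel[OF f] by blast
  have Y: "Y \<in> objects \<A>" and X: "X \<in> objects \<A>"
    using Hom_objects f by blast+
  have "c \<cdot> ident \<A> Y = zero_arr \<A> Y C"
    using epic_zeroD[OF e f c(2) cokernel_zero[OF c f]] ident_right[OF c(2)] by simp
  then obtain h where h: "h \<in> Hom \<A> Y X" "f \<cdot> h = ident \<A> Y"
    using kernel_lift[OF monic_is_kernel[OF m f c] f c(2) ident_Hom[OF Y]] by blast
  have "f \<cdot> (h \<cdot> f) = f \<cdot> ident \<A> X"
    using comp_assoc[OF f h(1) f] h ident_left[OF f] ident_right[OF f] by simp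
  then have "h \<cdot> f = ident \<A> X"
    using monicD[OF m f] comp_Hom f h(1) ident_Hom[OF X] by blast
  then show ?thesis
    using iso_arrI f h by blast
qed

lemma epic_monic_factorization:
  assumes f: "f \<in> Hom \<A> X Y"
  obtains J p j where "p \<in> Hom \<A> X J" "epic \<A> p" "j \<in> Hom \<A> J Y" "monic \<A> j" "f = j \<cdot> p"
proof -
  obtain k p j c where k: "is_kernel \<A> k f" and c: "is_cokernel \<A> c f" and p: "is_cokernel \<A> p k"
    and j: "is_kernel \<A> j c" and pj: "tgt \<A> p = src \<A> j" "j \<cdot> p = f"
    using image_factorization[of f] f Hom_arrow(1) by metis
  have "p \<in> Hom \<A> X (src \<A> j)"
    using cokernel_Hom[OF p kernel_Hom[OF k f]] pj by simp
  moreover have "j \<in> Hom \<A> (src \<A> j) Y"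
    using kernel_Hom[OF j cokernel_Hom[OF c f]] .
  ultimately show thesis
    using that cokernel_epic[OF p] kernel_monic[OF j] pj(2) by blast
qed

lemma zero_objectI:
  assumes Z: "Z \<in> objects \<A>" and "ident \<A> Z = zero_arr \<A> Z Z"
  shows "zero_object \<A> Z"
proof -
  have "f = zero_arr \<A> Z Y" if "f \<in> Hom \<A> Z Y" for f Y
    using ident_right[OF that] comp_zero[OF Z that] assms by simp
  moreover have "f = zero_arr \<A> Y Z" if "f \<in> Hom \<A> Y Z" for f Y
    using ident_left[OF that] zero_comp[OF Z that] assms by simp
  ultimately show ?thesis
    unfolding zero_object_def using zero_Hom Z by blast
qed

lemma zero_object_into: "zero_object \<A> Z \<Longrightarrow> f \<in> Hom \<A> Y Z \<Longrightarrow> f = zero_arr \<A> Y Z"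
  using Hom_objects unfolding zero_object_def by blast

lemma zero_object_from: "zero_object \<A> Z \<Longrightarrow> f \<in> Hom \<A> Z Y \<Longrightarrow> f = zero_arr \<A> Z Y"
  using Hom_objects unfolding zero_object_def by blast

lemma zero_object_monic: "zero_object \<A> Z \<Longrightarrow> i \<in> Hom \<A> Z Y \<Longrightarrow> monic \<A> i"
  using monicI zero_object_into by metis

lemma zero_monic:
  assumes "monic \<A> i" "i \<in> Hom \<A> X Y" "i = zero_arr \<A> X Y"
  shows "zero_object \<A> X"
proof (rule zero_objectI)
  show X: "X \<in> objects \<A>"
    using assms Hom_objects by blast
  show "ident \<A> X = zero_arr \<A> X X"
    using monic_zeroD[OF assms(1,2) ident_Hom[OF X]] ident_right[OF assms(2)] assms(3) by simp
qed

lemma zero_epic: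
  assumes "epic \<A> p" "p \<in> Hom \<A> X Y" "p = zero_arr \<A> X Y"
  shows "zero_object \<A> Y"
  using abelian_category.zero_monic[OF opposite_abelian, of p Y X] assms by simp

lemma iso_obj_refl: "X \<in> objects \<A> \<Longrightarrow> iso_obj \<A> X X"
  unfolding iso_obj_def using ident_iso ident_Hom by blast

lemma iso_obj_sym: "iso_obj \<A> X Y \<Longrightarrow> iso_obj \<A> Y X"
  unfolding iso_obj_def using iso_arrE by metis

lemma iso_obj_trans: "iso_obj \<A> X Y \<Longrightarrow> iso_obj \<A> Y Z \<Longrightarrow> iso_obj \<A> X Z"
  unfolding iso_obj_def using iso_comp comp_Hom by metis

end

section \<open>Short exact sequences and series\<close>

text \<open>
  The sequence \<open>0 \<rightarrow> A \<rightarrow> X \<rightarrow> Q \<rightarrow> 0\<close>. It names the objects along with the arrows because all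
  composites are typed by Hom-sets.
\<close>

definition short_exact :: "('o, 'm) additive_data \<Rightarrow> 'o \<Rightarrow> 'm \<Rightarrow> 'o \<Rightarrow> 'm \<Rightarrow> 'o \<Rightarrow> bool" where
  "short_exact \<A> A a X e Q \<longleftrightarrow>
     a \<in> Hom \<A> A X \<and> e \<in> Hom \<A> X Q \<and> is_kernel \<A> a e \<and> is_cokernel \<A> e a"

text \<open>
  The composition factors of an object in ascending order, defined on objects rather than on filtrations:
  a series of \<open>X\<close> extends a series of a maximal subobject \<open>B\<close> by the factor \<open>X/B\<close>. In this form series
  can be handled by induction, and compared across objects without transporting subobjects.
\<close>

inductive has_series :: "('o, 'm) additive_data \<Rightarrow> 'o \<Rightarrow> 'o list \<Rightarrow> bool" for \<A> where
  zero: "zero_object \<A> Z \<Longrightarrow> has_series \<A> Z []"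
| extend: "has_series \<A> B Ts \<Longrightarrow> short_exact \<A> B b X t T \<Longrightarrow> simple_object \<A> T \<Longrightarrow>
    has_series \<A> X (Ts @ [T])"

context abelian_category
begin

lemma short_exactD:
  assumes "short_exact \<A> A a X e Q"
  shows "a \<in> Hom \<A> A X" "e \<in> Hom \<A> X Q" "is_kernel \<A> a e" "is_cokernel \<A> e a"
    "monic \<A> a" "epic \<A> e" "e \<cdot> a = zero_arr \<A> A Q"
    "A \<in> objects \<A>" "X \<in> objects \<A>" "Q \<in> objects \<A>"
  using assms kernel_monic cokernel_epic kernel_zero Hom_objects unfolding short_exact_def by metis+

lemma short_exact_kernelI:
  "e \<in> Hom \<A> X Q \<Longrightarrow> epic \<A> e \<Longrightarrow> a \<in> Hom \<A> A X \<Longrightarrow> is_kernel \<A> a e \<Longrightarrow> short_exact \<A> A a X e Q"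
  unfolding short_exact_def using epic_is_cokernel by blast

lemma short_exact_cokernelI:
  "a \<in> Hom \<A> A X \<Longrightarrow> monic \<A> a \<Longrightarrow> e \<in> Hom \<A> X Q \<Longrightarrow> is_cokernel \<A> e a \<Longrightarrow> short_exact \<A> A a X e Q"
  unfolding short_exact_def using monic_is_kernel by blast

lemma ex_short_exact_epic:
  assumes "epic \<A> e" "e \<in> Hom \<A> X Q"
  obtains A a where "short_exact \<A> A a X e Q"
  using ex_kernel[OF assms(2)] short_exact_kernelI assms by blast

lemma ex_short_exact_monic:
  assumes "monic \<A> a" "a \<in> Hom \<A> A X"
  obtains Q e where "short_exact \<A> A a X e Q"
  using ex_cokernel[OF assms(2)] short_exact_cokernelI assms by blast

lemma short_exact_lift:
  assumes "short_exact \<A> A a X e Q" "g \<in> Hom \<A> W X" "e \<cdot> g = zero_arr \<A> W Q"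
  obtains h where "h \<in> Hom \<A> W A" "a \<cdot> h = g"
  using kernel_lift[OF _ _ _ assms(2,3)] short_exactD(1-3)[OF assms(1)] by blast

lemma short_exact_colift:
  assumes "short_exact \<A> A a X e Q" "g \<in> Hom \<A> X W" "g \<cdot> a = zero_arr \<A> A W"
  obtains h where "h \<in> Hom \<A> Q W" "h \<cdot> e = g"
  using cokernel_lift[OF _ _ _ assms(2,3)] short_exactD(1,2,4)[OF assms(1)] by blast

text \<open>
  Only the middle term moves: the kernel is composed with \<open>h\<close>, the cokernel with its inverse.
\<close>

lemma short_exact_iso:
  assumes X: "short_exact \<A> A a X e Q" and h: "iso_arr \<A> h" "h \<in> Hom \<A> X Y"
  obtains a' e' where "short_exact \<A> A a' Y e' Q"
proof -
  note x = short_exactD[OF X]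
  obtain g where g: "g \<in> Hom \<A> Y X" "g \<cdot> h = ident \<A> X" "h \<cdot> g = ident \<A> Y" "iso_arr \<A> g"
    using iso_arrE[OF h] .
  have "is_kernel \<A> (h \<cdot> a) (e \<cdot> g)"
  proof (rule is_kernelI[OF comp_Hom[OF x(1) h(2)] _ comp_Hom[OF g(1) x(2)]])
    show "monic \<A> (h \<cdot> a)"
      using monic_comp[OF x(5,1)] iso_monic h by blast
    have "(e \<cdot> g) \<cdot> (h \<cdot> a) = e \<cdot> ((g \<cdot> h) \<cdot> a)"
      using comp_assoc[OF comp_Hom[OF x(1) h(2)] g(1) x(2)] comp_assoc[OF x(1) h(2) g(1)] by simp
    then show "(e \<cdot> g) \<cdot> (h \<cdot> a) = zero_arr \<A> A Q"
      using g(2) ident_left[OF x(1)] x(7) by simp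
  next
    fix W y
    assume y: "y \<in> Hom \<A> W Y" "(e \<cdot> g) \<cdot> y = zero_arr \<A> W Q"
    then have "e \<cdot> (g \<cdot> y) = zero_arr \<A> W Q"
      using comp_assoc[OF y(1) g(1) x(2)] by simp
    then obtain w where w: "w \<in> Hom \<A> W A" "a \<cdot> w = g \<cdot> y"
      using short_exact_lift[OF X comp_Hom[OF y(1) g(1)]] by blast
    have "(h \<cdot> a) \<cdot> w = (h \<cdot> g) \<cdot> y"
      using comp_assoc[OF w(1) x(1) h(2)] comp_assoc[OF y(1) g(1) h(2)] w(2) by simp
    then show "\<exists>w \<in> Hom \<A> W A. (h \<cdot> a) \<cdot> w = y"
      using w(1) g(3) ident_left[OF y(1)] by auto
  qed
  then show thesis
    using that short_exact_kernelI comp_Hom[OF x(1) h(2)] comp_Hom[OF g(1) x(2)]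
      epic_comp[OF iso_epic[OF g(4,1)] g(1) x(6,2)] by blast
qed

lemma zero_object_iso:
  assumes Z: "zero_object \<A> Z" and h: "iso_arr \<A> h" "h \<in> Hom \<A> Z Y"
  shows "zero_object \<A> Y"
  using zero_epic[OF iso_epic[OF h] h(2)] zero_object_from[OF Z h(2)] by simp

lemma has_series_object: "has_series \<A> X Ts \<Longrightarrow> X \<in> objects \<A>"
  by (cases rule: has_series.cases) (auto simp: zero_object_def dest: short_exactD(9))

lemma has_series_iso:
  assumes "has_series \<A> X Ts" and h: "iso_arr \<A> h" "h \<in> Hom \<A> X Y"
  shows "has_series \<A> Y Ts"
  using assms(1)
proof cases
  case zero
  then show ?thesis
    using has_series.zero[OF zero_object_iso[OF _ h]] by simp
next
  case (extend B Ts' b t T)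
  then show ?thesis
    using short_exact_iso[OF _ h] has_series.extend by metis
qed

lemma has_series_Nil: "has_series \<A> X [] \<Longrightarrow> zero_object \<A> X"
  by (cases rule: has_series.cases) auto

text \<open>
  \<open>X'\<close> is the preimage of \<open>Q'\<close> under the epimorphism \<open>e\<close>, and \<open>r\<close> the restriction of \<open>e\<close>. If \<open>g\<close> kills
  \<open>r\<close>, then the image of \<open>r\<close> lies in \<open>J = ker g\<close>. The quotient arrow of \<open>Q\<close> by \<open>J\<close> kills the image
  of \<open>X'\<close>, so it factors through \<open>X/X' = Q/Q'\<close> and kills \<open>Q'\<close>; therefore \<open>J = Q'\<close> and \<open>g = 0\<close>.
\<close>

lemma epic_restrict:
  assumes X: "short_exact \<A> X' x X (t \<cdot> e) T" and Q: "short_exact \<A> Q' q Q t T"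
    and e: "epic \<A> e" "e \<in> Hom \<A> X Q" and r: "r \<in> Hom \<A> X' Q'" "q \<cdot> r = e \<cdot> x"
  shows "epic \<A> r"
proof (rule epicI[OF r(1)])
  fix W g
  assume g: "g \<in> Hom \<A> Q' W" "g \<cdot> r = zero_arr \<A> X' W"
  note x = short_exactD[OF X] and q = short_exactD[OF Q]
  obtain J j where j: "is_kernel \<A> j g" "j \<in> Hom \<A> J Q'"
    using ex_kernel[OF g(1)] by blast
  obtain s where s: "s \<in> Hom \<A> X' J" "j \<cdot> s = r"
    using kernel_lift[OF j g(1) r(1) g(2)] .
  have qjH: "q \<cdot> j \<in> Hom \<A> J Q"
    using comp_Hom[OF j(2) q(1)] .
  obtain C c where c: "short_exact \<A> J (q \<cdot> j) Q c C"
    using ex_short_exact_monic[OF monic_comp[OF kernel_monic[OF j(1)] j(2) q(5,1)] qjH] .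
  note cD = short_exactD[OF c]
  have "(c \<cdot> e) \<cdot> x = c \<cdot> ((q \<cdot> j) \<cdot> s)"
    using comp_assoc[OF x(1) e(2) cD(2)] comp_assoc[OF s(1) j(2) q(1)] r(2) s(2) by simp
  also have "\<dots> = zero_arr \<A> X' C"
    using comp_assoc[OF s(1) qjH cD(2)] cD(7) zero_comp[OF cD(10) s(1)] by simp
  finally obtain u where u: "u \<in> Hom \<A> T C" "u \<cdot> (t \<cdot> e) = c \<cdot> e"
    using short_exact_colift[OF X comp_Hom[OF e(2) cD(2)]] by blast
  have "u \<cdot> t = c"
    using epicD[OF e comp_Hom[OF q(2) u(1)] cD(2)] comp_assoc[OF e(2) q(2) u(1)] u(2) by simp
  then have "c \<cdot> q = zero_arr \<A> Q' C"
    using comp_assoc[OF q(1,2) u(1)] q(7) comp_zero[OF q(8) u(1)] by simp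
  then obtain v where v: "v \<in> Hom \<A> Q' J" "(q \<cdot> j) \<cdot> v = q"
    using short_exact_lift[OF c q(1)] by blast
  have "q \<cdot> (j \<cdot> v) = q \<cdot> ident \<A> Q'"
    using v(2) comp_assoc[OF v(1) j(2) q(1)] ident_right[OF q(1)] by simp
  then have "j \<cdot> v = ident \<A> Q'"
    using monicD[OF q(5,1)] comp_Hom[OF v(1) j(2)] ident_Hom q(8) by blast
  then have "g = (g \<cdot> j) \<cdot> v"
    using comp_assoc[OF v(1) j(2) g(1)] ident_right[OF g(1)] by simp
  then show "g = zero_arr \<A> Q' W"
    using kernel_zero[OF j g(1)] zero_comp[OF Hom_objects(2)[OF g(1)] v(1)] by simp
qed

text \<open>
  For \<open>A \<subseteq> X' \<subseteq> X\<close> with \<open>X/A = Q\<close> and \<open>X'\<close> the preimage of \<open>Q' \<subseteq> Q\<close>, this is \<open>X'/A = Q'\<close>.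
\<close>

lemma short_exact_restrict:
  assumes A: "short_exact \<A> A a X e Q" and X: "short_exact \<A> X' x X (t \<cdot> e) T"
    and Q: "short_exact \<A> Q' q Q t T"
  obtains a' e' where "short_exact \<A> A a' X' e' Q'"
proof -
  note a = short_exactD[OF A] and xD = short_exactD[OF X] and qD = short_exactD[OF Q]
  have "t \<cdot> (e \<cdot> x) = zero_arr \<A> X' T"
    using comp_assoc[OF xD(1) a(2) qD(2)] xD(7) by simp
  then obtain r where r: "r \<in> Hom \<A> X' Q'" "q \<cdot> r = e \<cdot> x"
    using short_exact_lift[OF Q comp_Hom[OF xD(1) a(2)]] by blast
  have "(t \<cdot> e) \<cdot> a = zero_arr \<A> A T"
    using comp_assoc[OF a(1,2) qD(2)] a(7) comp_zero[OF a(8) qD(2)] by simp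
  then obtain s where s: "s \<in> Hom \<A> A X'" "x \<cdot> s = a"
    using short_exact_lift[OF X a(1)] by blast
  have "is_kernel \<A> s r"
  proof (rule is_kernelI[OF s(1) _ r(1)])
    show "monic \<A> s"
      using monic_cancel[OF _ s(1) xD(1)] s(2) a(5) by simp
    have "q \<cdot> (r \<cdot> s) = e \<cdot> a"
      using comp_assoc[OF s(1) r(1) qD(1)] comp_assoc[OF s(1) xD(1) a(2)] r s by simp
    then show "r \<cdot> s = zero_arr \<A> A Q'"
      using monic_zeroD[OF qD(5,1) comp_Hom[OF s(1) r(1)]] a(7) by simp
  next
    fix W g
    assume g: "g \<in> Hom \<A> W X'" "r \<cdot> g = zero_arr \<A> W Q'"
    have "e \<cdot> (x \<cdot> g) = q \<cdot> (r \<cdot> g)"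
      using comp_assoc[OF g(1) r(1) qD(1)] comp_assoc[OF g(1) xD(1) a(2)] r by simp
    also have "\<dots> = zero_arr \<A> W Q"
      using g comp_zero[OF Hom_objects(1)[OF g(1)] qD(1)] by simp
    finally obtain h where h: "h \<in> Hom \<A> W A" "a \<cdot> h = x \<cdot> g"
      using short_exact_lift[OF A comp_Hom[OF g(1) xD(1)]] by blast
    have "x \<cdot> (s \<cdot> h) = x \<cdot> g"
      using comp_assoc[OF h(1) s(1) xD(1)] s h by simp
    then have "s \<cdot> h = g"
      using monicD[OF xD(5,1) comp_Hom[OF h(1) s(1)] g(1)] by simp
    then show "\<exists>h \<in> Hom \<A> W A. s \<cdot> h = g"
      using h by blast
  qed
  then show thesis
    using that short_exact_kernelI[OF r(1) epic_restrict[OF X Q a(6,2) r] s(1)] by blast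
qed

text \<open>
  Since \<open>A \<rightarrow> X/X'\<close> is epic, \<open>A + X' = X\<close>; with \<open>A' = A \<inter> X'\<close> this is the second isomorphism theorem
  \<open>X'/(A \<inter> X') = (A + X')/A = X/A\<close>.
\<close>

lemma short_exact_restrict_epic:
  assumes A: "short_exact \<A> A a X e Q" and X: "short_exact \<A> X' x X t T"
    and K: "short_exact \<A> A' k A (t \<cdot> a) T"
  obtains a' e' where "short_exact \<A> A' a' X' e' Q"
proof -
  note aD = short_exactD[OF A] and xD = short_exactD[OF X] and kD = short_exactD[OF K]
  have "t \<cdot> (a \<cdot> k) = zero_arr \<A> A' T"
    using comp_assoc[OF kD(1) aD(1) xD(2)] kD(7) by simp
  then obtain s where s: "s \<in> Hom \<A> A' X'" "x \<cdot> s = a \<cdot> k"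
    using short_exact_lift[OF X comp_Hom[OF kD(1) aD(1)]] by blast
  have ex: "e \<cdot> x \<in> Hom \<A> X' Q"
    using comp_Hom[OF xD(1) aD(2)] .
  have "is_kernel \<A> s (e \<cdot> x)"
  proof (rule is_kernelI[OF s(1) _ ex])
    show "monic \<A> s"
      using monic_cancel[OF _ s(1) xD(1)] s(2) monic_comp[OF kD(5,1) aD(5,1)] by simp
    have "(e \<cdot> x) \<cdot> s = (e \<cdot> a) \<cdot> k"
      using comp_assoc[OF s(1) xD(1) aD(2)] comp_assoc[OF kD(1) aD(1,2)] s by simp
    then show "(e \<cdot> x) \<cdot> s = zero_arr \<A> A' Q"
      using aD(7) zero_comp[OF aD(10) kD(1)] by simp
  next
    fix W g
    assume g: "g \<in> Hom \<A> W X'" "(e \<cdot> x) \<cdot> g = zero_arr \<A> W Q"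
    then have "e \<cdot> (x \<cdot> g) = zero_arr \<A> W Q"
      using comp_assoc[OF g(1) xD(1) aD(2)] by simp
    then obtain h where h: "h \<in> Hom \<A> W A" "a \<cdot> h = x \<cdot> g"
      using short_exact_lift[OF A comp_Hom[OF g(1) xD(1)]] by blast
    have "(t \<cdot> a) \<cdot> h = (t \<cdot> x) \<cdot> g"
      using comp_assoc[OF h(1) aD(1) xD(2)] comp_assoc[OF g(1) xD(1,2)] h by simp
    also have "\<dots> = zero_arr \<A> W T"
      using xD(7) zero_comp[OF xD(10) g(1)] by simp
    finally obtain w where w: "w \<in> Hom \<A> W A'" "k \<cdot> w = h"
      using short_exact_lift[OF K h(1)] by blast
    have "x \<cdot> (s \<cdot> w) = x \<cdot> g"
      using comp_assoc[OF w(1) s(1) xD(1)] comp_assoc[OF w(1) kD(1) aD(1)] s w h by simp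
    then have "s \<cdot> w = g"
      using monicD[OF xD(5,1) comp_Hom[OF w(1) s(1)] g(1)] by simp
    then show "\<exists>h \<in> Hom \<A> W A'. s \<cdot> h = g"
      using w by blast
  qed
  moreover have "epic \<A> (e \<cdot> x)"
  proof (rule epicI[OF ex])
    fix W g
    assume g: "g \<in> Hom \<A> Q W" "g \<cdot> (e \<cdot> x) = zero_arr \<A> X' W"
    note W = Hom_objects(2)[OF g(1)]
    have "(g \<cdot> e) \<cdot> x = zero_arr \<A> X' W"
      using comp_assoc[OF xD(1) aD(2) g(1)] g by simp
    then obtain h where h: "h \<in> Hom \<A> T W" "h \<cdot> t = g \<cdot> e"
      using short_exact_colift[OF X comp_Hom[OF aD(2) g(1)]] by blast
    have "h \<cdot> (t \<cdot> a) = g \<cdot> (e \<cdot> a)"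
      using comp_assoc[OF aD(1) xD(2) h(1)] comp_assoc[OF aD(1,2) g(1)] h by simp
    also have "\<dots> = zero_arr \<A> A W"
      using aD(7) comp_zero[OF aD(8) g(1)] by simp
    finally have "h = zero_arr \<A> T W"
      using epic_zeroD[OF kD(6,2) h(1)] by simp
    then have "g \<cdot> e = zero_arr \<A> X W"
      using h zero_comp[OF W xD(2)] by simp
    then show "g = zero_arr \<A> Q W"
      using epic_zeroD[OF aD(6,2) g(1)] by simp
  qed
  ultimately show thesis
    using that short_exact_kernelI[OF ex _ s(1)] by blast
qed

lemma full_sub_iso:
  assumes "i \<in> full_sub \<A> X" "i \<in> Hom \<A> Y X" "X \<in> objects \<A>"
  shows "iso_arr \<A> i"
proof -
  obtain h where h: "h \<in> Hom \<A> X Y" "iso_arr \<A> h" "ident \<A> X = i \<cdot> h"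
    using assms ident_Hom[OF assms(3)] unfolding full_sub_def subobject_rel_def Hom_def by auto
  obtain g where g: "g \<in> Hom \<A> Y X" "h \<cdot> g = ident \<A> Y" "iso_arr \<A> g"
    using iso_arrE[OF h(2,1)] by blast
  have "i = (i \<cdot> h) \<cdot> g"
    using comp_assoc[OF g(1) h(1) assms(2)] g ident_right[OF assms(2)] by simp
  then show ?thesis
    using h g ident_left[OF g(1)] by simp
qed

text \<open>
  The image of \<open>f\<close> is a subobject of the simple object \<open>T\<close>, so it is zero or all of \<open>T\<close>.
\<close>

lemma simple_epic:
  assumes T: "simple_object \<A> T" and f: "f \<in> Hom \<A> X T" and nz: "f \<noteq> zero_arr \<A> X T"
  shows "epic \<A> f"
proof -
  obtain J p j where p: "p \<in> Hom \<A> X J" "epic \<A> p" and j: "j \<in> Hom \<A> J T" "monic \<A> j"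
    and fj: "f = j \<cdot> p"
    using epic_monic_factorization[OF f] .
  have X: "X \<in> objects \<A>" and J: "J \<in> objects \<A>" and TO: "T \<in> objects \<A>"
    using Hom_objects p j by blast+
  let ?U = "subobject_rel \<A> T `` {j}"
  have "(j, j) \<in> subobject_rel \<A> T"
    unfolding subobject_rel_def
    using j ident_Hom[OF J] ident_iso[OF J] ident_right[OF j(1)]
    by (auto simp: Hom_def intro!: bexI[of _ "ident \<A> J"])
  then have jU: "j \<in> ?U"
    by blast
  have "?U \<in> subobjects \<A> T"
    unfolding subobjects_def using j by (intro quotientI) (auto simp: Hom_def)
  then consider "j \<in> zero_sub \<A> T" | "j \<in> full_sub \<A> T"
    using T jU unfolding simple_object_def by blast
  then show ?thesis
  proof cases
    case 1
    then have "zero_object \<A> J"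
      using j by (simp add: zero_sub_def Hom_def)
    then have "f = zero_arr \<A> X T"
      using zero_object_into[of J p X] p fj comp_zero[OF X j(1)] by simp
    with nz show ?thesis
      by simp
  next
    case 2
    then show ?thesis
      using full_sub_iso[OF _ j(1) TO] iso_epic j epic_comp[OF p(2,1)] fj by blast
  qed
qed

end

section \<open>Factors of multiplicity-free objects\<close>

definition iso_class :: "('o, 'm) additive_data \<Rightarrow> 'o \<Rightarrow> 'o set" where
  "iso_class \<A> T = {Y. iso_obj \<A> T Y}"

text \<open>
  By the Jordan--Hoelder theorem the choice of the series does not matter; see \<open>factors_eq\<close>.
\<close>

definition factors :: "('o, 'm) additive_data \<Rightarrow> 'o \<Rightarrow> 'o set multiset" where
  "factors \<A> X = image_mset (iso_class \<A>) (mset (SOME Ts. has_series \<A> X Ts))"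

definition multiplicity_free :: "('o, 'm) additive_data \<Rightarrow> 'o \<Rightarrow> bool" where
  "multiplicity_free \<A> X \<longleftrightarrow> (\<exists>Ts. has_series \<A> X Ts) \<and> (\<forall>C. count (factors \<A> X) C \<le> 1)"

abbreviation factor_set :: "('o, 'm) additive_data \<Rightarrow> 'o \<Rightarrow> 'o set set" where
  "factor_set \<A> X \<equiv> set_mset (factors \<A> X)"

context abelian_category
begin

lemma iso_class_eq_iff:
  "X \<in> objects \<A> \<Longrightarrow> Y \<in> objects \<A> \<Longrightarrow> iso_class \<A> X = iso_class \<A> Y \<longleftrightarrow> iso_obj \<A> X Y"
  using iso_obj_refl iso_obj_sym iso_obj_trans unfolding iso_class_def by blast

text \<open>
  Induction on the series of \<open>Q\<close>: if \<open>Q'\<close> is the maximal subobject in the last step of that series,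
  its preimage \<open>X'\<close> in \<open>X\<close> is an extension of \<open>Q'\<close> by \<open>A\<close>, and \<open>X/X' = Q/Q'\<close>.
\<close>

lemma has_series_append:
  assumes "has_series \<A> Q Rs" and A: "has_series \<A> A Ls" and "short_exact \<A> A a X e Q"
  shows "has_series \<A> X (Ls @ Rs)"
  using assms(1,3)
proof (induction arbitrary: a X e rule: has_series.induct)
  case (zero Q)
  note aD = short_exactD[OF zero(2)]
  have "epic \<A> a"
  proof (rule epicI[OF aD(1)])
    fix W g
    assume g: "g \<in> Hom \<A> X W" "g \<cdot> a = zero_arr \<A> A W"
    obtain h where h: "h \<in> Hom \<A> Q W" "h \<cdot> e = g"
      using short_exact_colift[OF zero(2) g] .
    then show "g = zero_arr \<A> X W"
      using zero_object_from[OF zero(1) h(1)] zero_comp[OF Hom_objects(2)[OF g(1)] aD(2)] by simp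
  qed
  then show ?case
    using has_series_iso[OF A monic_epic_iso[OF aD(5) _ aD(1)] aD(1)] by simp
next
  case (extend Q' Ts q Q t T)
  note aD = short_exactD[OF extend.prems] and qD = short_exactD[OF extend.hyps(2)]
  have te: "t \<cdot> e \<in> Hom \<A> X T"
    using comp_Hom[OF aD(2) qD(2)] .
  obtain X' x where X: "short_exact \<A> X' x X (t \<cdot> e) T"
    using ex_short_exact_epic[OF epic_comp[OF aD(6,2) qD(6,2)] te] .
  obtain a' e' where "short_exact \<A> A a' X' e' Q'"
    using short_exact_restrict[OF extend.prems X extend.hyps(2)] .
  then have "has_series \<A> X' (Ls @ Ts)"
    using extend.IH by blast
  then show ?case
    using has_series.extend[OF _ X extend.hyps(3), of "Ls @ Ts"] by simp
qed

text \<open>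
  Induction on the series of \<open>X\<close>, with last step \<open>X' \<subseteq> X\<close> and top factor \<open>T = X/X'\<close>. The composite
  \<open>A \<rightarrow> X \<rightarrow> T\<close> is zero or epic. If it is zero, then \<open>A \<subseteq> X'\<close> and \<open>T\<close> is the top factor of \<open>Q\<close>; if
  it is epic, \<open>T\<close> is the top factor of \<open>A\<close>. In both cases the other factors come from \<open>X'\<close>. Beyond additivity,
  this provides series for all subobjects and quotients of \<open>X\<close>.
\<close>

lemma has_series_split:
  assumes "has_series \<A> X Ls" and "short_exact \<A> A a X e Q"
  shows "\<exists>Ms Ns. has_series \<A> A Ms \<and> has_series \<A> Q Ns \<and> mset Ls = mset Ms + mset Ns"
  using assms
proof (induction arbitrary: A a e Q rule: has_series.induct)
  case (zero X)
  note aD = short_exactD[OF zero(2)]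
  have "zero_object \<A> A"
    using zero_monic[OF aD(5,1)] zero_object_into[OF zero(1) aD(1)] by simp
  moreover have "zero_object \<A> Q"
    using zero_epic[OF aD(6,2)] zero_object_from[OF zero(1) aD(2)] by simp
  ultimately show ?case
    using has_series.zero by fastforce
next
  case (extend X' Ts x X t T)
  note aD = short_exactD[OF extend.prems] and xD = short_exactD[OF extend.hyps(2)]
  show ?case
  proof (cases "t \<cdot> a = zero_arr \<A> A T")
    case True
    obtain u where u: "u \<in> Hom \<A> Q T" "u \<cdot> e = t"
      using short_exact_colift[OF extend.prems xD(2) True] .
    have "epic \<A> u"
      using epic_cancel[OF _ aD(2) u(1)] u(2) xD(6) by simp
    then obtain Q' q where Q: "short_exact \<A> Q' q Q u T"
      using ex_short_exact_epic u(1) by blast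
    have X: "short_exact \<A> X' x X (u \<cdot> e) T"
      using extend.hyps(2) u(2) by simp
    obtain a' e' where "short_exact \<A> A a' X' e' Q'"
      using short_exact_restrict[OF extend.prems X Q] .
    from extend.IH[OF this] obtain Ms Ns where
      IH: "has_series \<A> A Ms" "has_series \<A> Q' Ns" "mset Ts = mset Ms + mset Ns"
      by blast
    have "has_series \<A> Q (Ns @ [T])"
      using has_series.extend[OF IH(2) Q extend.hyps(3)] .
    moreover have "mset (Ts @ [T]) = mset Ms + mset (Ns @ [T])"
      using IH(3) by simp
    ultimately show ?thesis
      using IH(1) by blast
  next
    case False
    have ta: "t \<cdot> a \<in> Hom \<A> A T"
      using comp_Hom[OF aD(1) xD(2)] .
    obtain A' k where K: "short_exact \<A> A' k A (t \<cdot> a) T"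
      using ex_short_exact_epic[OF simple_epic[OF extend.hyps(3) ta False] ta] .
    obtain a' e' where "short_exact \<A> A' a' X' e' Q"
      using short_exact_restrict_epic[OF extend.prems extend.hyps(2) K] .
    from extend.IH[OF this] obtain Ms Ns where
      IH: "has_series \<A> A' Ms" "has_series \<A> Q Ns" "mset Ts = mset Ms + mset Ns"
      by blast
    have "has_series \<A> A (Ms @ [T])"
      using has_series.extend[OF IH(1) K extend.hyps(3)] .
    moreover have "mset (Ts @ [T]) = mset (Ms @ [T]) + mset Ns"
      using IH(3) by simp
    ultimately show ?thesis
      using IH(2) by blast
  qed
qed

lemma has_series_zero_object:
  assumes "has_series \<A> X Ts" and X: "zero_object \<A> X"
  shows "Ts = []"
  using assms(1)
proof cases
  case (extend B Ts' b t T)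
  note bD = short_exactD[OF extend(3)]
  have "zero_object \<A> T"
    using zero_epic[OF bD(6,2)] zero_object_from[OF X bD(2)] by simp
  with extend(4) show ?thesis
    by (simp add: simple_object_def)
qed

lemma has_series_simple_object:
  assumes "has_series \<A> T Ts" and T: "simple_object \<A> T"
  obtains T' where "Ts = [T']" "iso_obj \<A> T T'"
  using assms(1)
proof cases
  case zero
  then show ?thesis
    using T by (simp add: simple_object_def)
next
  case (extend B Ts' b t T')
  note bD = short_exactD[OF extend(3)]
  have T': "\<not> zero_object \<A> T'"
    using extend(4) by (simp add: simple_object_def)
  have b: "b = zero_arr \<A> B T"
  proof (rule ccontr)
    assume "b \<noteq> zero_arr \<A> B T"
    then have "t = zero_arr \<A> T T'"
      using epic_zeroD[OF simple_epic[OF T bD(1)] bD(1,2)] bD(7) by blast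
    then show False
      using zero_epic[OF bD(6,2)] T' by blast
  qed
  then have "zero_object \<A> B"
    using zero_monic[OF bD(5,1)] by blast
  then have "Ts' = []"
    using has_series_zero_object extend(2) by blast
  moreover have "monic \<A> t"
  proof (rule monicI[OF bD(2)])
    fix W g
    assume g: "g \<in> Hom \<A> W T" "t \<cdot> g = zero_arr \<A> W T'"
    obtain h where h: "h \<in> Hom \<A> W B" "b \<cdot> h = g"
      using short_exact_lift[OF extend(3) g] .
    then show "g = zero_arr \<A> W T"
      using b zero_comp[OF bD(9) h(1)] by simp
  qed
  then have "iso_obj \<A> T T'"
    using monic_epic_iso bD(6,2) unfolding iso_obj_def by blast
  ultimately show ?thesis
    using that extend(1) by simp
qed

text \<open>
  Splitting one series along the last step of the other isolates a single factor isomorphic to \<open>T\<close>, which can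
  be cancelled.
\<close>

lemma jordan_hoelder:
  assumes "has_series \<A> X Ls" and "has_series \<A> X Rs"
  shows "image_mset (iso_class \<A>) (mset Ls) = image_mset (iso_class \<A>) (mset Rs)"
  using assms(2,1)
proof (induction arbitrary: Ls rule: has_series.induct)
  case (zero X)
  then show ?case
    using has_series_zero_object by fastforce
next
  case (extend B Ts b X t T)
  obtain Ms Ns where s: "has_series \<A> B Ms" "has_series \<A> T Ns" "mset Ls = mset Ms + mset Ns"
    using has_series_split[OF extend.prems extend.hyps(2)] by blast
  obtain T' where T': "Ns = [T']" "iso_obj \<A> T T'"
    using has_series_simple_object[OF s(2) extend.hyps(3)] .
  have "T \<in> objects \<A>" "T' \<in> objects \<A>"
    using T'(2) Hom_objects unfolding iso_obj_def by blast+
  then have "iso_class \<A> T = iso_class \<A> T'"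
    using T'(2) iso_class_eq_iff by blast
  then show ?case
    using s T' extend.IH[OF s(1)] by simp
qed

lemma factors_eq:
  assumes "has_series \<A> X Ts"
  shows "factors \<A> X = image_mset (iso_class \<A>) (mset Ts)"
  unfolding factors_def using jordan_hoelder[OF someI[of "has_series \<A> X"]] assms by blast

lemma factors_short_exact:
  assumes "has_series \<A> X Ls" and "short_exact \<A> A a X e Q"
  shows "factors \<A> X = factors \<A> A + factors \<A> Q"
  using has_series_split[OF assms] factors_eq[OF assms(1)] factors_eq by force

lemma multiplicity_free_short_exact:
  assumes X: "multiplicity_free \<A> X" and a: "short_exact \<A> A a X e Q"
  shows "multiplicity_free \<A> A" "multiplicity_free \<A> Q"
    "factor_set \<A> X = factor_set \<A> A \<union> factor_set \<A> Q" "factor_set \<A> A \<inter> factor_set \<A> Q = {}"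
proof -
  obtain Ls where Ls: "has_series \<A> X Ls" and "\<And>C. count (factors \<A> X) C \<le> 1"
    using X by (auto simp: multiplicity_free_def)
  then have c: "count (factors \<A> A) C + count (factors \<A> Q) C \<le> 1" for C
    using factors_short_exact[OF Ls a] by (metis count_union)
  show "factor_set \<A> X = factor_set \<A> A \<union> factor_set \<A> Q"
    using factors_short_exact[OF Ls a] by simp
  show "factor_set \<A> A \<inter> factor_set \<A> Q = {}"
  proof -
    have False if "C \<in># factors \<A> A" "C \<in># factors \<A> Q" for C
      using c[of C] that[unfolded count_greater_zero_iff[symmetric]] by linarith
    then show ?thesis
      by blast
  qed
  have "count (factors \<A> A) C \<le> 1" "count (factors \<A> Q) C \<le> 1" for C
    using c[of C] by linarith+
  then show "multiplicity_free \<A> A" "multiplicity_free \<A> Q"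
    using has_series_split[OF Ls a] unfolding multiplicity_free_def by blast+
qed

lemma factor_set_monic:
  assumes "multiplicity_free \<A> X" "monic \<A> i" "i \<in> Hom \<A> A X"
  shows "factor_set \<A> A \<subseteq> factor_set \<A> X"
proof -
  obtain Q e where "short_exact \<A> A i X e Q"
    using ex_short_exact_monic assms by blast
  then show ?thesis
    using multiplicity_free_short_exact(3) assms(1) by blast
qed

lemma factor_set_epic:
  assumes "multiplicity_free \<A> X" "epic \<A> e" "e \<in> Hom \<A> X Q"
  shows "factor_set \<A> Q \<subseteq> factor_set \<A> X"
proof -
  obtain A a where "short_exact \<A> A a X e Q"
    using ex_short_exact_epic assms by blast
  then show ?thesis
    using multiplicity_free_short_exact(3) assms(1) by blast
qed

lemma factor_set_empty:
  assumes "multiplicity_free \<A> X" "factor_set \<A> X = {}"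
  shows "zero_object \<A> X"
proof -
  obtain Ts where "has_series \<A> X Ts"
    using assms by (auto simp: multiplicity_free_def)
  moreover from this have "Ts = []"
    using factors_eq assms(2) by fastforce
  ultimately show ?thesis
    using has_series_Nil by blast
qed

text \<open>
  \<open>J\<close> is the image of the subobject \<open>A\<close> in the quotient \<open>R = X/B\<close>: a quotient of \<open>A\<close> and a subobject of \<open>R\<close>.
  The comparison of subobjects and quotients below rests on its having only factors common to both.
\<close>

lemma subobject_image_in_quotient:
  assumes X: "multiplicity_free \<A> X"
    and a: "short_exact \<A> A a X e Q" and b: "short_exact \<A> B b X f R"
  obtains J p j where "p \<in> Hom \<A> A J" "epic \<A> p" "j \<in> Hom \<A> J R" "monic \<A> j" "f \<cdot> a = j \<cdot> p"
    "factor_set \<A> J \<subseteq> factor_set \<A> A \<inter> factor_set \<A> R" "multiplicity_free \<A> J"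
proof -
  note aD = short_exactD[OF a] and bD = short_exactD[OF b]
  obtain J p j where J: "p \<in> Hom \<A> A J" "epic \<A> p" "j \<in> Hom \<A> J R" "monic \<A> j" "f \<cdot> a = j \<cdot> p"
    using epic_monic_factorization[OF comp_Hom[OF aD(1) bD(2)]] .
  have A: "multiplicity_free \<A> A" and R: "multiplicity_free \<A> R"
    using multiplicity_free_short_exact X a b by blast+
  obtain K k where "short_exact \<A> K k A p J"
    using ex_short_exact_epic J by blast
  then have "multiplicity_free \<A> J"
    using multiplicity_free_short_exact A by blast
  then show thesis
    using that J factor_set_epic[OF A J(2,1)] factor_set_monic[OF R J(4,3)] by blast
qed

text \<open>
  \<open>C\<close> is the kernel of \<open>A \<rightarrow> X/B\<close>. The factors of \<open>A\<close> lost in \<open>C\<close> are those of the image in \<open>X/B\<close>,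
  and they are not factors of \<open>B\<close>.
\<close>

lemma ex_intersection:
  assumes X: "multiplicity_free \<A> X"
    and a: "short_exact \<A> A a X e Q" and b: "short_exact \<A> B b X f R"
  obtains C c r P where "short_exact \<A> C c X r P" "factor_set \<A> C = factor_set \<A> A \<inter> factor_set \<A> B"
proof -
  note aD = short_exactD[OF a] and bD = short_exactD[OF b]
  obtain J p j where J: "p \<in> Hom \<A> A J" "epic \<A> p" "j \<in> Hom \<A> J R" "monic \<A> j" "f \<cdot> a = j \<cdot> p"
    "factor_set \<A> J \<subseteq> factor_set \<A> A \<inter> factor_set \<A> R"
    using subobject_image_in_quotient[OF assms] .
  obtain C k where k: "short_exact \<A> C k A p J"
    using ex_short_exact_epic J by blast
  note kD = short_exactD[OF k]
  have A: "multiplicity_free \<A> A" and B: "multiplicity_free \<A> B"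
    using multiplicity_free_short_exact X a b by blast+
  have akH: "a \<cdot> k \<in> Hom \<A> C X" and ak: "monic \<A> (a \<cdot> k)"
    using comp_Hom[OF kD(1) aD(1)] monic_comp[OF kD(5,1) aD(5,1)] by blast+
  have "f \<cdot> (a \<cdot> k) = j \<cdot> (p \<cdot> k)"
    using comp_assoc[OF kD(1) aD(1) bD(2)] comp_assoc[OF kD(1) J(1,3)] J(5) by simp
  also have "\<dots> = zero_arr \<A> C R"
    using kD(7) comp_zero[OF kD(8) J(3)] by simp
  finally obtain h where h: "h \<in> Hom \<A> C B" "b \<cdot> h = a \<cdot> k"
    using short_exact_lift[OF b akH] by blast
  have "monic \<A> h"
    using monic_cancel[OF _ h(1) bD(1)] h(2) ak by simp
  then have "factor_set \<A> C \<subseteq> factor_set \<A> B"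
    using factor_set_monic[OF B _ h(1)] by blast
  moreover have "factor_set \<A> A = factor_set \<A> C \<union> factor_set \<A> J"
    using multiplicity_free_short_exact[OF A k] by blast
  moreover have "factor_set \<A> B \<inter> factor_set \<A> R = {}"
    using multiplicity_free_short_exact[OF X b] by blast
  ultimately have "factor_set \<A> C = factor_set \<A> A \<inter> factor_set \<A> B"
    using J(6) by blast
  moreover obtain r P where "short_exact \<A> C (a \<cdot> k) X r P"
    using ex_short_exact_monic[OF ak akH] by blast
  ultimately show thesis
    using that by blast
qed

text \<open>
  The quotient by the sum is the cokernel \<open>P\<close> of \<open>A \<rightarrow> X/B\<close>. The factors of \<open>X/B\<close> lost in \<open>P\<close> are those of the
  image of \<open>A\<close>, and they are not factors of \<open>X/A\<close>; so \<open>P\<close> has the common factors of \<open>X/A\<close> and \<open>X/B\<close>.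
\<close>

lemma ex_sum:
  assumes X: "multiplicity_free \<A> X"
    and a: "short_exact \<A> A a X e Q" and b: "short_exact \<A> B b X f R"
  obtains C c r P where "short_exact \<A> C c X r P" "factor_set \<A> C = factor_set \<A> A \<union> factor_set \<A> B"
proof -
  note aD = short_exactD[OF a] and bD = short_exactD[OF b]
  obtain J p j where J: "p \<in> Hom \<A> A J" "epic \<A> p" "j \<in> Hom \<A> J R" "monic \<A> j" "f \<cdot> a = j \<cdot> p"
    "factor_set \<A> J \<subseteq> factor_set \<A> A \<inter> factor_set \<A> R"
    using subobject_image_in_quotient[OF assms] .
  obtain P k where k: "short_exact \<A> J j R k P"
    using ex_short_exact_monic J by blast
  note kD = short_exactD[OF k]
  have Q: "multiplicity_free \<A> Q" and R: "multiplicity_free \<A> R"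
    using multiplicity_free_short_exact X a b by blast+
  have kfH: "k \<cdot> f \<in> Hom \<A> X P" and kf: "epic \<A> (k \<cdot> f)"
    using comp_Hom[OF bD(2) kD(2)] epic_comp[OF bD(6,2) kD(6,2)] by blast+
  have "(k \<cdot> f) \<cdot> a = (k \<cdot> j) \<cdot> p"
    using comp_assoc[OF aD(1) bD(2) kD(2)] comp_assoc[OF J(1,3) kD(2)] J(5) by simp
  also have "\<dots> = zero_arr \<A> A P"
    using kD(7) zero_comp[OF kD(10) J(1)] by simp
  finally obtain h where h: "h \<in> Hom \<A> Q P" "h \<cdot> e = k \<cdot> f"
    using short_exact_colift[OF a kfH] by blast
  have "epic \<A> h"
    using epic_cancel[OF _ aD(2) h(1)] h(2) kf by simp
  then have "factor_set \<A> P \<subseteq> factor_set \<A> Q"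
    using factor_set_epic[OF Q _ h(1)] by blast
  moreover have "factor_set \<A> R = factor_set \<A> J \<union> factor_set \<A> P"
    using multiplicity_free_short_exact[OF R k] by blast
  moreover obtain C c where c: "short_exact \<A> C c X (k \<cdot> f) P"
    using ex_short_exact_epic[OF kf kfH] by blast
  ultimately have "factor_set \<A> C = factor_set \<A> A \<union> factor_set \<A> B"
    using J(6) multiplicity_free_short_exact(3,4)[OF X a] multiplicity_free_short_exact(3,4)[OF X b]
      multiplicity_free_short_exact(3,4)[OF X c] by blast
  then show thesis
    using that c by blast
qed

text \<open>
  The image of \<open>A\<close> in \<open>R\<close> has factors common to \<open>A\<close> and \<open>Q = X/A\<close>; there are none, so \<open>A\<close> is
  killed by \<open>f\<close>.
\<close>

lemma quotient_le:
  assumes X: "multiplicity_free \<A> X"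
    and a: "short_exact \<A> A a X e Q" and b: "short_exact \<A> B b X f R"
    and le: "factor_set \<A> R \<subseteq> factor_set \<A> Q"
  obtains h where "h \<in> Hom \<A> Q R" "f = h \<cdot> e"
proof -
  note aD = short_exactD[OF a] and bD = short_exactD[OF b]
  obtain J p j where J: "p \<in> Hom \<A> A J" "j \<in> Hom \<A> J R" "f \<cdot> a = j \<cdot> p"
    "factor_set \<A> J \<subseteq> factor_set \<A> A \<inter> factor_set \<A> R" "multiplicity_free \<A> J"
    using subobject_image_in_quotient[OF X a b] .
  have "factor_set \<A> J = {}"
    using J(4) le multiplicity_free_short_exact(4)[OF X a] by blast
  then have "p = zero_arr \<A> A J"
    using zero_object_into factor_set_empty J by blast
  then have "f \<cdot> a = zero_arr \<A> A R"
    using J(3) comp_zero[OF aD(8) J(2)] by simp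
  then show thesis
    using short_exact_colift[OF a bD(2)] that by blast
qed

lemma epic_mutual_iso:
  assumes e: "epic \<A> e" "e \<in> Hom \<A> X Q" and f: "epic \<A> f" "f \<in> Hom \<A> X R"
    and h: "h \<in> Hom \<A> Q R" "f = h \<cdot> e" and g: "g \<in> Hom \<A> R Q" "e = g \<cdot> f"
  shows "iso_arr \<A> h"
proof -
  have "(g \<cdot> h) \<cdot> e = ident \<A> Q \<cdot> e"
    using comp_assoc[OF e(2) h(1) g(1)] h(2)[symmetric] g(2)[symmetric] ident_left[OF e(2)] by simp
  then have gh: "g \<cdot> h = ident \<A> Q"
    using epicD[OF e] comp_Hom[OF h(1) g(1)] ident_Hom Hom_objects(2)[OF e(2)] by blast
  have "(h \<cdot> g) \<cdot> f = ident \<A> R \<cdot> f"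
    using comp_assoc[OF f(2) g(1) h(1)] h(2)[symmetric] g(2)[symmetric] ident_left[OF f(2)] by simp
  then have "h \<cdot> g = ident \<A> R"
    using epicD[OF f] comp_Hom[OF g(1) h(1)] ident_Hom Hom_objects(2)[OF f(2)] by blast
  then show ?thesis
    using iso_arrI[OF h(1) g(1) gh] by blast
qed

lemma quotient_unique:
  assumes X: "multiplicity_free \<A> X"
    and a: "short_exact \<A> A a X e Q" and b: "short_exact \<A> B b X f R"
    and eq: "factor_set \<A> R = factor_set \<A> Q"
  obtains h where "h \<in> Hom \<A> Q R" "iso_arr \<A> h" "f = h \<cdot> e"
proof -
  obtain h where h: "h \<in> Hom \<A> Q R" "f = h \<cdot> e"
    using quotient_le[OF X a b] eq by blast
  obtain g where g: "g \<in> Hom \<A> R Q" "e = g \<cdot> f"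
    using quotient_le[OF X b a] eq by blast
  show thesis
    using that h epic_mutual_iso[OF short_exactD(6,2)[OF a] short_exactD(6,2)[OF b] h g] by blast
qed

end

section \<open>Composition series\<close>

context abelian_category
begin

lemma subobject_relI:
  assumes "monic \<A> i" "i \<in> Hom \<A> A X" "monic \<A> j" "j \<in> Hom \<A> B X"
    "h \<in> Hom \<A> A B" "iso_arr \<A> h" "i = j \<cdot> h"
  shows "(i, j) \<in> subobject_rel \<A> X"
  using assms unfolding subobject_rel_def Hom_def by auto

lemma subobject_relE:
  assumes "(i, j) \<in> subobject_rel \<A> X"
  obtains A B h where "monic \<A> i" "i \<in> Hom \<A> A X" "monic \<A> j" "j \<in> Hom \<A> B X"
    "h \<in> Hom \<A> A B" "iso_arr \<A> h" "i = j \<cdot> h"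
  using assms unfolding subobject_rel_def monic_def Hom_def by auto

lemma subobject_rel_refl: "monic \<A> i \<Longrightarrow> i \<in> Hom \<A> A X \<Longrightarrow> (i, i) \<in> subobject_rel \<A> X"
  using subobject_relI[of i A X i A "ident \<A> A"] ident_Hom ident_iso ident_right Hom_objects
  by simp

lemma subobject_class:
  assumes "monic \<A> i" "i \<in> Hom \<A> A X"
  shows "subobject_rel \<A> X `` {i} \<in> subobjects \<A> X"
  unfolding subobjects_def by (rule quotientI) (use assms in \<open>simp add: Hom_def\<close>)

lemma subobjects_monic:
  assumes "U \<in> subobjects \<A> X" "i \<in> U"
  shows "monic \<A> i" "i \<in> Hom \<A> (src \<A> i) X"
proof -
  obtain x where "(x, i) \<in> subobject_rel \<A> X"
    using assms unfolding subobjects_def by (auto elim: quotientE)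
  then show "monic \<A> i" "i \<in> Hom \<A> (src \<A> i) X"
    using subobject_relE Hom_arrow by metis+
qed

lemma subobjects_iso:
  assumes "U \<in> subobjects \<A> X" "i \<in> U" "j \<in> U"
  obtains h where "h \<in> Hom \<A> (src \<A> i) (src \<A> j)" "iso_arr \<A> h"
proof -
  obtain x where "(x, i) \<in> subobject_rel \<A> X" "(x, j) \<in> subobject_rel \<A> X"
    using assms unfolding subobjects_def by (auto elim: quotientE)
  then obtain h g where h: "h \<in> Hom \<A> (src \<A> x) (src \<A> i)" "iso_arr \<A> h"
    and g: "g \<in> Hom \<A> (src \<A> x) (src \<A> j)" "iso_arr \<A> g"
    unfolding subobject_rel_def by blast
  obtain h' where "h' \<in> Hom \<A> (src \<A> i) (src \<A> x)" "iso_arr \<A> h'"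
    using iso_arrE[OF h(2,1)] by blast
  then show thesis
    using that iso_comp[OF _ _ g(2,1)] comp_Hom g(1) by blast
qed

text \<open>
  The inclusion \<open>h\<close> of \<open>U\<close> in \<open>V\<close> is monic because \<open>i = j \<cdot> h\<close> is, so it is the kernel of its cokernel.
\<close>

lemma is_factor_short_exact:
  assumes "is_factor \<A> U V T" and U: "U \<in> subobjects \<A> X" and V: "V \<in> subobjects \<A> X"
  obtains i j h t where "i \<in> U" "j \<in> V" "short_exact \<A> (src \<A> i) h (src \<A> j) t T"
proof -
  obtain i j h t where i: "i \<in> U" and j: "j \<in> V" and h: "h \<in> Hom \<A> (src \<A> i) (src \<A> j)"
    and ij: "i = j \<cdot> h" and t: "is_cokernel \<A> t h" "tgt \<A> t = T"
    using assms(1) unfolding is_factor_def by blast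
  have "monic \<A> h"
    using monic_cancel[OF _ h subobjects_monic(2)[OF V j]] subobjects_monic(1)[OF U i] ij by simp
  then have "short_exact \<A> (src \<A> i) h (src \<A> j) t T"
    using short_exact_cokernelI[OF h] cokernel_Hom[OF t(1) h] t by simp
  then show thesis
    using that i j by blast
qed

text \<open>
  The representatives of each \<open>B k\<close> carry the series \<open>T 1, \<dots>, T k\<close>; any two of them are isomorphic, so it does
  not matter which ones witness the factors on either side of \<open>B k\<close>.
\<close>

lemma composition_series_has_series:
  assumes B: "composition_series \<A> X n B T" and X: "X \<in> objects \<A>"
  shows "has_series \<A> X (map T [1..<Suc n])"
proof -
  have *: "\<forall>i \<in> B k. has_series \<A> (src \<A> i) (map T [1..<Suc k])" if "k \<le> n" for k
    using that
  proof (induction k)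
    case 0
    then show ?case
      using B has_series.zero by (auto simp: composition_series_def zero_sub_def)
  next
    case (Suc k)
    have U: "B k \<in> subobjects \<A> X" and V: "B (Suc k) \<in> subobjects \<A> X"
      using B Suc.prems by (auto simp: composition_series_def)
    have "is_factor \<A> (B k) (B (Suc k)) (T (Suc k))" and S: "simple_object \<A> (T (Suc k))"
      using B Suc.prems unfolding composition_series_def by force+
    from is_factor_short_exact[OF this(1) U V] obtain i j h t where i: "i \<in> B k"
      and j: "j \<in> B (Suc k)" and t: "short_exact \<A> (src \<A> i) h (src \<A> j) t (T (Suc k))" .
    have "has_series \<A> (src \<A> j) (map T [1..<Suc k] @ [T (Suc k)])"
      using has_series.extend[OF _ t S] Suc i by auto
    then have "has_series \<A> (src \<A> j) (map T [1..<Suc (Suc k)])"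
      by simp
    then show ?case
      using subobjects_iso[OF V j] has_series_iso by metis
  qed
  have "ident \<A> X \<in> B n"
    using B subobject_rel_refl[OF ident_monic ident_Hom] X
    by (auto simp: composition_series_def full_sub_def)
  then show ?thesis
    using *[of n] Hom_arrow(2)[OF ident_Hom[OF X]] by (metis order_refl)
qed

lemma zero_sub_class:
  assumes Z: "zero_object \<A> Z" and m: "m \<in> Hom \<A> Z X"
  shows "subobject_rel \<A> X `` {m} = zero_sub \<A> X"
proof (intro equalityI subsetI)
  fix i
  assume "i \<in> subobject_rel \<A> X `` {m}"
  then obtain h where "monic \<A> i" "tgt \<A> i = X" "h \<in> Hom \<A> Z (src \<A> i)" "iso_arr \<A> h"
    using m by (auto simp: subobject_rel_def Hom_def)
  then show "i \<in> zero_sub \<A> X"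
    using zero_object_iso[OF Z] by (simp add: zero_sub_def)
next
  fix i
  assume "i \<in> zero_sub \<A> X"
  then have i: "monic \<A> i" "i \<in> Hom \<A> (src \<A> i) X" "zero_object \<A> (src \<A> i)"
    by (auto simp: zero_sub_def monic_def Hom_def)
  define z where "z = zero_arr \<A> Z (src \<A> i)"
  have z: "z \<in> Hom \<A> Z (src \<A> i)"
    using zero_Hom Z i by (simp add: z_def zero_object_def)
  have "epic \<A> z"
    using epicI[OF z] zero_object_from[OF i(3)] by blast
  then have "iso_arr \<A> z"
    using monic_epic_iso[OF zero_object_monic[OF Z z] _ z] by blast
  moreover have "m = i \<cdot> z"
    using zero_object_from[OF Z] m comp_Hom[OF z i(2)] by metis
  ultimately show "i \<in> subobject_rel \<A> X `` {m}"
    using subobject_relI[OF zero_object_monic[OF Z m] m i(1,2) z] by blast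
qed

text \<open>
  The converse construction, stated for a subobject \<open>m\<close> of \<open>X\<close> so that the induction can descend along
  \<open>A' \<subseteq> A \<subseteq> X\<close> while all subobjects stay subobjects of the same \<open>X\<close>.
\<close>

lemma has_series_filtration:
  assumes "has_series \<A> A Ts" and "monic \<A> m" "m \<in> Hom \<A> A X"
  shows "\<exists>B. (\<forall>k \<le> length Ts. B k \<in> subobjects \<A> X) \<and> B 0 = zero_sub \<A> X \<and>
    B (length Ts) = subobject_rel \<A> X `` {m} \<and>
    (\<forall>k \<in> {1..length Ts}. is_factor \<A> (B (k - 1)) (B k) (Ts ! (k - 1)) \<and>
      simple_object \<A> (Ts ! (k - 1)))"
  using assms
proof (induction arbitrary: m rule: has_series.induct)
  case (zero Z)
  then show ?case
    using subobject_class zero_sub_class by (intro exI[of _ "\<lambda>_. zero_sub \<A> X"]) force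
next
  case (extend A' Ts a A t T)
  note aD = short_exactD[OF extend.hyps(2)]
  let ?n = "length Ts"
  have ma: "monic \<A> (m \<cdot> a)" "m \<cdot> a \<in> Hom \<A> A' X"
    using monic_comp[OF aD(5,1) extend.prems] comp_Hom[OF aD(1) extend.prems(2)] by blast+
  obtain B where B: "\<forall>k \<le> ?n. B k \<in> subobjects \<A> X" "B 0 = zero_sub \<A> X"
    "B ?n = subobject_rel \<A> X `` {m \<cdot> a}"
    "\<forall>k \<in> {1..?n}. is_factor \<A> (B (k - 1)) (B k) (Ts ! (k - 1)) \<and> simple_object \<A> (Ts ! (k - 1))"
    using extend.IH[OF ma] by blast
  define B' where "B' = B(Suc ?n := subobject_rel \<A> X `` {m})"
  have top: "is_factor \<A> (B ?n) (subobject_rel \<A> X `` {m}) T"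
    unfolding is_factor_def
  proof (intro bexI conjI exI)
    show "m \<cdot> a = m \<cdot> a" "is_cokernel \<A> t a" "tgt \<A> t = T"
      using aD Hom_arrow by auto
    show "a \<in> Hom \<A> (src \<A> (m \<cdot> a)) (src \<A> m)"
      using aD(1) ma extend.prems Hom_arrow by metis
    show "m \<in> subobject_rel \<A> X `` {m}" "m \<cdot> a \<in> B ?n"
      using B(3) subobject_rel_refl ma extend.prems by auto
  qed
  have "is_factor \<A> (B' (k - 1)) (B' k) ((Ts @ [T]) ! (k - 1)) \<and>
      simple_object \<A> ((Ts @ [T]) ! (k - 1))" if "k \<in> {1..Suc ?n}" for k
  proof (cases "k = Suc ?n")
    case True
    then show ?thesis
      using top extend.hyps(3) by (simp add: B'_def)
  next
    case False
    then have "k \<in> {1..?n}" "k - 1 < ?n"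
      using that by auto
    then show ?thesis
      using B(4) by (auto simp: B'_def nth_append)
  qed
  moreover have "\<forall>k \<le> Suc ?n. B' k \<in> subobjects \<A> X"
    using B(1) subobject_class[OF extend.prems] by (auto simp: B'_def le_Suc_eq)
  moreover have "B' 0 = zero_sub \<A> X" "B' (Suc ?n) = subobject_rel \<A> X `` {m}"
    using B(2) by (simp_all add: B'_def)
  ultimately show ?case
    by (intro exI[of _ B']) simp
qed

lemma has_series_composition_series:
  assumes "has_series \<A> X Ts"
  obtains B where "composition_series \<A> X (length Ts) B (\<lambda>k. Ts ! (k - 1))"
proof -
  have X: "X \<in> objects \<A>"
    using has_series_object assms .
  show thesis
    using has_series_filtration[OF assms ident_monic[OF X] ident_Hom[OF X]] that
    unfolding composition_series_def full_sub_def by blast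
qed

text \<open>
  The initial segments of a series belong to subobjects of \<open>X\<close>, the terms of the filtration.
\<close>

lemma has_series_take:
  assumes "has_series \<A> X Ts" "k \<le> length Ts"
  shows "\<exists>A a. monic \<A> a \<and> a \<in> Hom \<A> A X \<and> has_series \<A> A (take k Ts)"
  using assms
proof (induction rule: has_series.induct)
  case (zero Z)
  then have "Z \<in> objects \<A>"
    by (simp add: zero_object_def)
  then show ?case
    using zero has_series.zero ident_monic ident_Hom by fastforce
next
  case (extend B Ts b X t T)
  note bD = short_exactD[OF extend.hyps(2)]
  show ?case
  proof (cases "k \<le> length Ts")
    case True
    then obtain A a where "monic \<A> a" "a \<in> Hom \<A> A B" "has_series \<A> A (take k Ts)"
      using extend.IH by blast
    then show ?thesis
      using True monic_comp[OF _ _ bD(5,1)] comp_Hom[OF _ bD(1)]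
      by (intro exI[of _ A] exI[of _ "b \<cdot> a"]) simp
  next
    case False
    then have "take k (Ts @ [T]) = Ts @ [T]"
      using extend.prems by simp
    then show ?thesis
      using has_series.extend[OF extend.hyps] ident_monic[OF bD(9)] ident_Hom[OF bD(9)] by metis
  qed
qed

lemma factor_matching_iff:
  assumes "finite K" "\<forall>i \<in> K. S i \<in> objects \<A>" "\<forall>k \<in> {1..n}. T k \<in> objects \<A>"
  shows "factor_matching \<A> K S n T \<phi> \<longleftrightarrow>
    bij_betw \<phi> K {1..n} \<and> (\<forall>i \<in> K. iso_class \<A> (S i) = iso_class \<A> (T (\<phi> i)))"
  unfolding factor_matching_def using iso_class_eq_iff assms bij_betwE by (metis (no_types, lifting))

text \<open>
  For pairwise nonisomorphic \<open>S i\<close> a matching with \<open>T 1, \<dots>, T n\<close> amounts to an equality of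
  multisets of isomorphism classes. Given the equality, the classes of the \<open>T k\<close> are distinct as well,
  by counting, and the matching sends \<open>i\<close> to the only \<open>k\<close> with the class of \<open>S i\<close>.
\<close>

lemma ex_factor_matching_iff:
  assumes K: "finite K" "inj_on (iso_class \<A> \<circ> S) K"
    and S: "\<forall>i \<in> K. S i \<in> objects \<A>" and T: "\<forall>k \<in> {1..n}. T k \<in> objects \<A>"
  shows "(\<exists>\<phi>. factor_matching \<A> K S n T \<phi>) \<longleftrightarrow>
    image_mset (iso_class \<A>) (mset (map T [1..<Suc n])) = mset_set ((iso_class \<A> \<circ> S) ` K)"
    (is "?L \<longleftrightarrow> ?R")
proof -
  have lists: "mset (map T [1..<Suc n]) = image_mset T (mset_set {1..n})"
    by (simp add: atLeastLessThanSuc_atLeastAtMost del: upt_Suc)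
  have cS: "mset_set ((iso_class \<A> \<circ> S) ` K) = image_mset (iso_class \<A> \<circ> S) (mset_set K)"
    using image_mset_mset_set[OF K(2)] by simp
  note match = factor_matching_iff[of K S n T, OF K(1) S T]
  show ?thesis
  proof
    assume ?L
    then obtain \<phi> where \<phi>: "bij_betw \<phi> K {1..n}"
        "\<forall>i \<in> K. iso_class \<A> (S i) = iso_class \<A> (T (\<phi> i))"
      using match by blast
    have "mset_set {1..n} = image_mset \<phi> (mset_set K)"
      using \<phi>(1) image_mset_mset_set[of \<phi> K] by (simp add: bij_betw_def)
    then have "image_mset (iso_class \<A>) (mset (map T [1..<Suc n])) =
        image_mset (\<lambda>i. iso_class \<A> (T (\<phi> i))) (mset_set K)"
      using lists by (simp add: image_mset.compositionality comp_def)
    also have "\<dots> = image_mset (iso_class \<A> \<circ> S) (mset_set K)"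
      using \<phi>(2) K(1) by (intro image_mset_cong) auto
    finally show ?R
      using cS by simp
  next
    assume R: ?R
    let ?f = "iso_class \<A> \<circ> S" and ?g = "iso_class \<A> \<circ> T"
    have R': "image_mset ?g (mset_set {1..n}) = mset_set (?f ` K)"
      using R unfolding lists by (simp add: image_mset.compositionality comp_def)
    then have "set_mset (image_mset ?g (mset_set {1..n})) = ?f ` K"
      using K(1) by simp
    then have im: "?g ` {1..n} = ?f ` K"
      by simp
    have "size (image_mset ?g (mset_set {1..n})) = size (mset_set (?f ` K))"
      using R' by simp
    then have "card (?g ` {1..n}) = card {1..n}"
      using im by simp
    then have inj: "inj_on ?g {1..n}"
      by (intro eq_card_imp_inj_on) auto
    define \<phi> where "\<phi> = inv_into {1..n} ?g \<circ> ?f"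
    have "bij_betw \<phi> K {1..n}"
      unfolding \<phi>_def using K(2) bij_betw_inv_into[OF inj_on_imp_bij_betw[OF inj]] im
      by (metis bij_betw_trans inj_on_imp_bij_betw)
    moreover have "?g (\<phi> i) = ?f i" if "i \<in> K" for i
      unfolding \<phi>_def using f_inv_into_f[of "?f i" ?g "{1..n}"] im that by simp
    ultimately show ?L
      using match by fastforce
  qed
qed

end

section \<open>Lower sets are realised by subobjects\<close>

lemma Inter_closed:
  assumes "\<And>M N. M \<in> F \<Longrightarrow> N \<in> F \<Longrightarrow> M \<inter> N \<in> F" "finite G" "G \<noteq> {}" "G \<subseteq> F"
  shows "\<Inter>G \<in> F"
  using assms(2-4) by (induction rule: finite_ne_induct) (use assms(1) in auto)

lemma Union_closed:
  assumes "\<And>M N. M \<in> F \<Longrightarrow> N \<in> F \<Longrightarrow> M \<union> N \<in> F" "{} \<in> F" "finite G" "G \<subseteq> F"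
  shows "\<Union>G \<in> F"
  using assms(3,4) by (induction rule: finite_induct) (use assms(1,2) in auto)

text \<open>
  Half of Birkhoff's representation of finite distributive lattices. The order induced by the ring
  of sets \<open>F\<close> puts \<open>x\<close> below \<open>y\<close> if every member that contains \<open>y\<close> contains \<open>x\<close>. The elements
  below \<open>y\<close> form the least member \<open>P y\<close> that contains \<open>y\<close>, and a lower set is the union of the \<open>P y\<close> of its
  elements.
\<close>

lemma lower_set_in_ring_of_sets:
  assumes C: "finite C" "F \<subseteq> Pow C" "{} \<in> F" "C \<in> F"
    and Int: "\<And>M N. M \<in> F \<Longrightarrow> N \<in> F \<Longrightarrow> M \<inter> N \<in> F"
    and Un: "\<And>M N. M \<in> F \<Longrightarrow> N \<in> F \<Longrightarrow> M \<union> N \<in> F"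
    and D: "D \<subseteq> C" "\<And>x y. x \<in> C \<Longrightarrow> y \<in> D \<Longrightarrow> (\<And>M. M \<in> F \<Longrightarrow> y \<in> M \<Longrightarrow> x \<in> M) \<Longrightarrow> x \<in> D"
  shows "D \<in> F"
proof -
  define P where "P y = \<Inter>{M \<in> F. y \<in> M}" for y
  have F: "finite F"
    using C finite_subset by blast
  have P: "P y \<in> F" if "y \<in> D" for y
    unfolding P_def
  proof (rule Inter_closed[OF Int])
    show "{M \<in> F. y \<in> M} \<noteq> {}"
      using C(4) D(1) that by blast
  qed (use F in auto)
  have "P y \<subseteq> D" if y: "y \<in> D" for y
  proof
    fix x
    assume x: "x \<in> P y"
    then have "x \<in> C"
      using C(4) D(1) y by (auto simp: P_def)
    then show "x \<in> D"
      using D(2) x y by (auto simp: P_def)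
  qed
  then have "\<Union>(P ` D) = D"
    by (auto simp: P_def)
  moreover have "\<Union>(P ` D) \<in> F"
    using Union_closed[OF Un C(3), where G = "P ` D"] P finite_subset[OF D(1) C(1)] by blast
  ultimately show ?thesis
    by simp
qed

lemma map_nth_pred: "map (\<lambda>k. xs ! (k - 1)) [1..<Suc (length xs)] = xs"
  by (rule nth_equalityI) (auto simp del: upt_Suc)

definition subobject_factor_sets :: "('o, 'm) additive_data \<Rightarrow> 'o \<Rightarrow> 'o set set set" where
  "subobject_factor_sets \<A> X = {factor_set \<A> A | A. \<exists>a e Q. short_exact \<A> A a X e Q}"

context abelian_category
begin

lemma ex_zero_subobject:
  assumes X: "X \<in> objects \<A>"
  obtains Z z r P where "zero_object \<A> Z" "short_exact \<A> Z z X r P"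
proof -
  obtain Z where Z: "zero_object \<A> Z"
    using ex_zero_object by blast
  then have z: "zero_arr \<A> Z X \<in> Hom \<A> Z X"
    using zero_Hom X by (simp add: zero_object_def)
  obtain P r where "short_exact \<A> Z (zero_arr \<A> Z X) X r P"
    using ex_short_exact_monic[OF zero_object_monic[OF Z z] z] .
  then show thesis
    using that Z by blast
qed

lemma subobject_factor_setsI:
  "short_exact \<A> A a X e Q \<Longrightarrow> factor_set \<A> A \<in> subobject_factor_sets \<A> X"
  unfolding subobject_factor_sets_def by blast

lemma subobject_factor_sets_monic:
  assumes "monic \<A> a" "a \<in> Hom \<A> A X"
  shows "factor_set \<A> A \<in> subobject_factor_sets \<A> X"
proof -
  obtain Q e where "short_exact \<A> A a X e Q"
    using ex_short_exact_monic[OF assms] .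
  then show ?thesis
    by (rule subobject_factor_setsI)
qed

lemma subobject_factor_sets_lower:
  assumes X: "multiplicity_free \<A> X" "X \<in> objects \<A>" and D: "D \<subseteq> factor_set \<A> X"
    "\<And>x y. x \<in> factor_set \<A> X \<Longrightarrow> y \<in> D \<Longrightarrow>
      (\<And>M. M \<in> subobject_factor_sets \<A> X \<Longrightarrow> y \<in> M \<Longrightarrow> x \<in> M) \<Longrightarrow> x \<in> D"
  shows "D \<in> subobject_factor_sets \<A> X"
proof (rule lower_set_in_ring_of_sets[where F = "subobject_factor_sets \<A> X" and C = "factor_set \<A> X"])
  show "subobject_factor_sets \<A> X \<subseteq> Pow (factor_set \<A> X)"
    using multiplicity_free_short_exact(3)[OF X(1)] unfolding subobject_factor_sets_def by blast
  obtain Z z r P where Z: "zero_object \<A> Z" "short_exact \<A> Z z X r P"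
    using ex_zero_subobject[OF X(2)] .
  then have "factor_set \<A> Z = {}"
    using factors_eq[OF has_series.zero] by simp
  then show "{} \<in> subobject_factor_sets \<A> X"
    using subobject_factor_setsI[OF Z(2)] by simp
  show "factor_set \<A> X \<in> subobject_factor_sets \<A> X"
    using subobject_factor_sets_monic[OF ident_monic ident_Hom] X(2) by blast
  fix M N
  assume "M \<in> subobject_factor_sets \<A> X" "N \<in> subobject_factor_sets \<A> X"
  then obtain A a e Q B b f R where MN: "M = factor_set \<A> A" "short_exact \<A> A a X e Q"
    "N = factor_set \<A> B" "short_exact \<A> B b X f R"
    unfolding subobject_factor_sets_def by blast
  show "M \<inter> N \<in> subobject_factor_sets \<A> X"
    using ex_intersection[OF X(1) MN(2,4)] subobject_factor_setsI unfolding MN(1,3) by metis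
  show "M \<union> N \<in> subobject_factor_sets \<A> X"
    using ex_sum[OF X(1) MN(2,4)] subobject_factor_setsI unfolding MN(1,3) by metis
next
  fix x y
  assume "x \<in> factor_set \<A> X" "y \<in> D"
    "\<And>M. M \<in> subobject_factor_sets \<A> X \<Longrightarrow> y \<in> M \<Longrightarrow> x \<in> M"
  then show "x \<in> D"
    by (rule D(2))
qed (simp_all add: D(1))

lemma multiplicity_free_factors:
  assumes "multiplicity_free \<A> X"
  shows "factors \<A> X = mset_set (factor_set \<A> X)"
proof (rule multiset_eqI)
  fix C
  have "count (factors \<A> X) C \<le> 1"
    using assms by (simp add: multiplicity_free_def)
  then show "count (factors \<A> X) C = count (mset_set (factor_set \<A> X)) C"
    by (cases "C \<in># factors \<A> X") (auto simp: count_mset_set' not_in_iff order.antisym)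
qed

lemma composition_series_objects:
  "composition_series \<A> X n B T \<Longrightarrow> \<forall>k \<in> {1..n}. T k \<in> objects \<A>"
  by (simp add: composition_series_def simple_object_def)

lemma nonisomorphic_simple_factorsD:
  assumes X: "X \<in> objects \<A>" and IS: "nonisomorphic_simple_factors \<A> X I S"
  shows "finite I" "\<forall>i \<in> I. S i \<in> objects \<A>" "inj_on (iso_class \<A> \<circ> S) I"
    "multiplicity_free \<A> X" "factor_set \<A> X = (iso_class \<A> \<circ> S) ` I"
proof -
  obtain n A R \<psi> where A: "composition_series \<A> X n A R"
    and R: "\<And>k l. 1 \<le> k \<Longrightarrow> k < l \<Longrightarrow> l \<le> n \<Longrightarrow> \<not> iso_obj \<A> (R k) (R l)"
    and \<psi>: "bij_betw \<psi> I {1..n}" "\<And>i. i \<in> I \<Longrightarrow> S i = R (\<psi> i)"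
    using IS unfolding nonisomorphic_simple_factors_def by blast
  note R_obj = composition_series_objects[OF A]
  show I: "finite I"
    using \<psi>(1) bij_betw_finite by blast
  show "\<forall>i \<in> I. S i \<in> objects \<A>"
    using R_obj \<psi> bij_betwE by metis
  have "iso_class \<A> (R k) \<noteq> iso_class \<A> (R l)" if "k \<in> {1..n}" "l \<in> {1..n}" "k < l" for k l
    using R[of k l] iso_class_eq_iff R_obj that by auto
  then have inj: "inj_on (iso_class \<A> \<circ> R) {1..n}"
    by (auto intro!: linorder_inj_onI)
  have "inj_on (iso_class \<A> \<circ> R \<circ> \<psi>) I"
    using \<psi>(1) inj by (auto simp: bij_betw_def intro!: comp_inj_on[of \<psi>])
  moreover have eq: "(iso_class \<A> \<circ> S) i = (iso_class \<A> \<circ> R \<circ> \<psi>) i" if "i \<in> I" for i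
    using \<psi>(2) that by simp
  ultimately show "inj_on (iso_class \<A> \<circ> S) I"
    by (simp cong: inj_on_cong)
  have series: "has_series \<A> X (map R [1..<Suc n])"
    using composition_series_has_series[OF A X] .
  have "mset (map R [1..<Suc n]) = image_mset R (mset_set {1..n})"
    by (simp add: atLeastLessThanSuc_atLeastAtMost del: upt_Suc)
  then have f: "factors \<A> X = mset_set ((iso_class \<A> \<circ> R) ` {1..n})"
    using factors_eq[OF series] image_mset_mset_set[OF inj]
    by (simp add: image_mset.compositionality comp_def)
  have "(iso_class \<A> \<circ> R) ` {1..n} = (iso_class \<A> \<circ> S) ` I"
    using \<psi> unfolding bij_betw_def by (metis (no_types, lifting) comp_apply image_cong image_image)
  then show "factor_set \<A> X = (iso_class \<A> \<circ> S) ` I"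
    using f I by simp
  show "multiplicity_free \<A> X"
    unfolding multiplicity_free_def f using series by (auto simp: count_mset_set')
qed

text \<open>
  If \<open>i \<preceq> j\<close> and \<open>A \<subseteq> X\<close> has \<open>S j\<close> among its factors, take a composition series of \<open>X\<close> that passes through \<open>A\<close>:
  the factors of \<open>A\<close> occupy an initial segment that contains the position of \<open>S j\<close>, hence also
  that of \<open>S i\<close>. Conversely, for a given series and matching \<open>\<phi>\<close>, apply the condition to the term of
  the filtration with index \<open>\<phi> j\<close>: it has \<open>S i\<close> among its factors, so \<open>\<phi> i \<le> \<phi> j\<close>.
\<close>

lemma factor_le_iff:
  assumes X: "X \<in> objects \<A>" and IS: "nonisomorphic_simple_factors \<A> X I S"
    and i: "i \<in> I" and j: "j \<in> I"
  shows "factor_le \<A> X I S i j \<longleftrightarrow>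
    (\<forall>M \<in> subobject_factor_sets \<A> X. iso_class \<A> (S j) \<in> M \<longrightarrow> iso_class \<A> (S i) \<in> M)"
proof -
  note ns = nonisomorphic_simple_factorsD[OF X IS]
  have inj: "k = l" if "k \<in> I" "l \<in> I" "iso_class \<A> (S k) = iso_class \<A> (S l)" for k l
    using inj_onD[OF ns(3), of k l] that by simp
  show ?thesis
  proof (intro iffI ballI impI)
    fix M
    assume le: "factor_le \<A> X I S i j" and "M \<in> subobject_factor_sets \<A> X"
      and jM: "iso_class \<A> (S j) \<in> M"
    then obtain A a e Q where A: "M = factor_set \<A> A" "short_exact \<A> A a X e Q"
      unfolding subobject_factor_sets_def by blast
    obtain Ls Rs where Ls: "has_series \<A> A Ls" and Rs: "has_series \<A> Q Rs"
      using multiplicity_free_short_exact(1,2)[OF ns(4) A(2)] unfolding multiplicity_free_def by blast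
    \<comment> \<open>List positions start at 0, indices of a composition series at 1.\<close>
    define Ts T where "Ts = Ls @ Rs" and "T = (\<lambda>k. Ts ! (k - 1))"
    have Ts: "has_series \<A> X Ts"
      unfolding Ts_def using has_series_append[OF Rs Ls A(2)] .
    obtain B where B: "composition_series \<A> X (length Ts) B T"
      using has_series_composition_series[OF Ts] unfolding T_def .
    have "mset (map T [1..<Suc (length Ts)]) = mset Ts"
      unfolding T_def map_nth_pred ..
    then have "image_mset (iso_class \<A>) (mset (map T [1..<Suc (length Ts)])) =
        mset_set ((iso_class \<A> \<circ> S) ` I)"
      using factors_eq[OF Ts] multiplicity_free_factors[OF ns(4)] ns(5) by simp
    then obtain \<phi> where \<phi>: "factor_matching \<A> I S (length Ts) T \<phi>"
      using ex_factor_matching_iff[OF ns(1,3,2) composition_series_objects[OF B]] by blast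
    then have \<phi>': "bij_betw \<phi> I {1..length Ts}"
      "\<And>k. k \<in> I \<Longrightarrow> iso_class \<A> (S k) = iso_class \<A> (T (\<phi> k))"
      using factor_matching_iff[OF ns(1,2) composition_series_objects[OF B]] by blast+
    have le: "\<phi> i \<le> \<phi> j"
      using le B \<phi> unfolding factor_le_def by blast
    obtain k where k: "k < length Ls" "iso_class \<A> (S j) = iso_class \<A> (Ls ! k)"
      using jM factors_eq[OF Ls] A(1) by (auto simp: in_set_conv_nth)
    have "Suc k \<in> {1..length Ts}"
      using k(1) by (simp add: Ts_def)
    then obtain j' where j': "j' \<in> I" "\<phi> j' = Suc k"
      using \<phi>'(1) by (metis bij_betw_def imageE)
    have Tk: "T (Suc k) = Ls ! k"
      using k(1) by (simp add: T_def Ts_def nth_append)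
    have "j' = j"
      by (rule inj[OF j'(1) j]) (simp only: \<phi>'(2)[OF j'(1)] j'(2) k(2) Tk)
    moreover have "\<phi> i \<in> {1..length Ts}"
      using \<phi>'(1) i bij_betwE by blast
    ultimately have "\<phi> i - 1 < length Ls"
      using le j' k(1) by auto
    then have "T (\<phi> i) \<in> set Ls"
      by (simp add: T_def Ts_def nth_append)
    then show "iso_class \<A> (S i) \<in> M"
      using \<phi>'(2)[OF i] factors_eq[OF Ls] A(1) by simp
  next
    assume M: "\<forall>M \<in> subobject_factor_sets \<A> X. iso_class \<A> (S j) \<in> M \<longrightarrow> iso_class \<A> (S i) \<in> M"
    have "\<phi> i \<le> \<phi> j" if B: "composition_series \<A> X n B T" and \<phi>: "factor_matching \<A> I S n T \<phi>"
      for n B T \<phi>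
    proof -
      have \<phi>': "bij_betw \<phi> I {1..n}"
        "\<And>k. k \<in> I \<Longrightarrow> iso_class \<A> (S k) = iso_class \<A> (T (\<phi> k))"
        using \<phi> factor_matching_iff[OF ns(1,2) composition_series_objects[OF B]] by blast+
      have ran: "\<phi> k \<in> {1..n}" if "k \<in> I" for k
        using \<phi>'(1) bij_betwE that by blast
      have Ts: "has_series \<A> X (map T [1..<Suc n])"
        using composition_series_has_series[OF B X] .
      obtain A a where a: "monic \<A> a" "a \<in> Hom \<A> A X"
        "has_series \<A> A (take (\<phi> j) (map T [1..<Suc n]))"
        using has_series_take[OF Ts, of "\<phi> j"] ran[OF j] by auto
      have "take (\<phi> j) (map T [1..<Suc n]) = map T [1..<Suc (\<phi> j)]"
        using ran[OF j] by (simp add: take_map del: upt_Suc)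
      then have A: "factor_set \<A> A = (iso_class \<A> \<circ> T) ` {1..\<phi> j}"
        using factors_eq[OF a(3)]
        by (simp add: atLeastLessThanSuc_atLeastAtMost image_comp del: upt_Suc)
      then have "iso_class \<A> (S j) \<in> factor_set \<A> A"
        using \<phi>'(2)[OF j] ran[OF j] by force
      then have "iso_class \<A> (S i) \<in> factor_set \<A> A"
        using M subobject_factor_sets_monic[OF a(1,2)] by blast
      then obtain k where k: "k \<in> {1..\<phi> j}" "iso_class \<A> (S i) = iso_class \<A> (T k)"
        using A by auto
      moreover have "k \<in> {1..n}"
        using k(1) ran[OF j] by simp
      ultimately obtain i' where i': "i' \<in> I" "\<phi> i' = k"
        using \<phi>'(1) by (metis bij_betw_def imageE)
      have "i' = i"
        by (rule inj[OF i'(1) i]) (simp only: \<phi>'(2)[OF i'(1)] i'(2) k(2))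
      then show ?thesis
        using i'(2) k(1) by simp
    qed
    then show "factor_le \<A> X I S i j"
      unfolding factor_le_def using i j by blast
  qed
qed

text \<open>
  The complement of a q-set is a lower set, hence the factor set of a subobject \<open>A\<close>, and the factors
  of \<open>X/A\<close> are then the remaining ones. Conversely, \<open>factor_le_iff\<close> makes the factor set of every
  subobject a lower set.
\<close>

lemma q_set_iff:
  assumes X: "X \<in> objects \<A>" and IS: "nonisomorphic_simple_factors \<A> X I S"
  shows "q_set \<A> X I S K \<longleftrightarrow> K \<subseteq> I \<and>
    (\<exists>A a e Q. short_exact \<A> A a X e Q \<and> factor_set \<A> Q = (iso_class \<A> \<circ> S) ` K)"
proof (intro iffI conjI)
  note ns = nonisomorphic_simple_factorsD[OF X IS]
  let ?c = "iso_class \<A> \<circ> S"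
  {
    assume K: "q_set \<A> X I S K"
    then show KI: "K \<subseteq> I"
      by (simp add: q_set_def)
    have "?c ` (I - K) \<in> subobject_factor_sets \<A> X"
    proof (rule subobject_factor_sets_lower[OF ns(4) X])
      show "?c ` (I - K) \<subseteq> factor_set \<A> X"
        using ns(5) by blast
      fix x y
      assume "x \<in> factor_set \<A> X" and y: "y \<in> ?c ` (I - K)"
        and *: "\<And>M. M \<in> subobject_factor_sets \<A> X \<Longrightarrow> y \<in> M \<Longrightarrow> x \<in> M"
      then obtain i where i: "i \<in> I" "x = ?c i"
        using ns(5) by blast
      obtain j where j: "j \<in> I" "j \<notin> K" "y = ?c j"
        using y by blast
      have "factor_le \<A> X I S i j"
        using factor_le_iff[OF X IS i(1) j(1)] * i(2) j(3) by auto
      then have "i \<notin> K"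
        using K j unfolding q_set_def by blast
      then show "x \<in> ?c ` (I - K)"
        using i by blast
    qed
    then obtain A a e Q where A: "?c ` (I - K) = factor_set \<A> A" "short_exact \<A> A a X e Q"
      unfolding subobject_factor_sets_def by blast
    have "factor_set \<A> Q = ?c ` I - ?c ` (I - K)"
      using multiplicity_free_short_exact(3,4)[OF ns(4) A(2)] A(1) ns(5) by auto
    also have "\<dots> = ?c ` K"
      using inj_on_image_set_diff[OF ns(3), of I "I - K"] KI by (simp add: double_diff)
    finally show "\<exists>A a e Q. short_exact \<A> A a X e Q \<and> factor_set \<A> Q = ?c ` K"
      using A(2) by blast
  next
    assume "K \<subseteq> I \<and> (\<exists>A a e Q. short_exact \<A> A a X e Q \<and> factor_set \<A> Q = ?c ` K)"
    then obtain A a e Q where KI: "K \<subseteq> I" and A: "short_exact \<A> A a X e Q" "factor_set \<A> Q = ?c ` K"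
      by (elim conjE exE) (rule that)
    note mf = multiplicity_free_short_exact(3,4)[OF ns(4) A(1)]
    have "i \<in> K" if i: "i \<in> I" and j: "j \<in> K" and le: "factor_le \<A> X I S j i" for i j
    proof (rule ccontr)
      assume "i \<notin> K"
      then have "?c i \<notin> ?c ` K"
        using inj_on_image_mem_iff[OF ns(3) i KI] by blast
      then have "?c i \<in> factor_set \<A> A"
        using mf(1) A(2) ns(5) i by blast
      moreover have "factor_set \<A> A \<in> subobject_factor_sets \<A> X"
        using subobject_factor_setsI[OF A(1)] .
      ultimately have "?c j \<in> factor_set \<A> A"
        using factor_le_iff[OF X IS _ i] le j KI by auto
      then show False
        using mf(2) A(2) j by blast
    qed
    then show "q_set \<A> X I S K"
      unfolding q_set_def using KI by blast
  }
qed

end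

section \<open>Quotient objects and q-sets\<close>

context abelian_category
begin

lemma equiv_quotient_rel: "equiv {p. epic \<A> p \<and> src \<A> p = X} (quotient_rel \<A> X)"
proof (rule equivI)
  show "quotient_rel \<A> X \<subseteq> {p. epic \<A> p \<and> src \<A> p = X} \<times> {p. epic \<A> p \<and> src \<A> p = X}"
    by (auto simp: quotient_rel_def)
  show "refl_on {p. epic \<A> p \<and> src \<A> p = X} (quotient_rel \<A> X)"
  proof (rule refl_onI)
    fix p
    assume "p \<in> {p. epic \<A> p \<and> src \<A> p = X}"
    then have p: "epic \<A> p" "p \<in> Hom \<A> X (tgt \<A> p)"
      by (auto simp: epic_def Hom_def)
    then show "(p, p) \<in> quotient_rel \<A> X"
      using ident_iso ident_Hom ident_left[OF p(2)] Hom_objects[OF p(2)] Hom_arrow(2)[OF p(2)]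
      unfolding quotient_rel_def by force
  qed
  show "sym (quotient_rel \<A> X)"
  proof (rule symI)
    fix p q
    assume "(p, q) \<in> quotient_rel \<A> X"
    then obtain h where pq: "epic \<A> p" "src \<A> p = X" "epic \<A> q" "src \<A> q = X"
      and h: "h \<in> Hom \<A> (tgt \<A> p) (tgt \<A> q)" "iso_arr \<A> h" "q = h \<cdot> p"
      unfolding quotient_rel_def by blast
    have p: "p \<in> Hom \<A> X (tgt \<A> p)"
      using pq by (auto simp: epic_def Hom_def)
    obtain g where g: "g \<in> Hom \<A> (tgt \<A> q) (tgt \<A> p)" "g \<cdot> h = ident \<A> (tgt \<A> p)" "iso_arr \<A> g"
      using iso_arrE[OF h(2,1)] by blast
    have "p = g \<cdot> q"
      using comp_assoc[OF p h(1) g(1)] g(2) h(3) ident_left[OF p] by simp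
    then show "(q, p) \<in> quotient_rel \<A> X"
      unfolding quotient_rel_def using pq g by blast
  qed
  show "trans (quotient_rel \<A> X)"
  proof (rule transI)
    fix p q r
    assume "(p, q) \<in> quotient_rel \<A> X" "(q, r) \<in> quotient_rel \<A> X"
    then obtain h g where pq: "epic \<A> p" "src \<A> p = X" "epic \<A> r" "src \<A> r = X"
      and h: "h \<in> Hom \<A> (tgt \<A> p) (tgt \<A> q)" "iso_arr \<A> h" "q = h \<cdot> p"
      and g: "g \<in> Hom \<A> (tgt \<A> q) (tgt \<A> r)" "iso_arr \<A> g" "r = g \<cdot> q"
      unfolding quotient_rel_def by blast
    have p: "p \<in> Hom \<A> X (tgt \<A> p)"
      using pq by (auto simp: epic_def Hom_def)
    have "r = (g \<cdot> h) \<cdot> p"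
      using comp_assoc[OF p h(1) g(1)] h(3) g(3) by simp
    then show "(p, r) \<in> quotient_rel \<A> X"
      unfolding quotient_rel_def using pq iso_comp[OF h(2,1) g(2,1)] comp_Hom[OF h(1) g(1)] by blast
  qed
qed

lemma quotient_objectE:
  assumes "Q \<in> quotient_objects \<A> X"
  obtains A a e Y where "short_exact \<A> A a X e Y" "Q = quotient_rel \<A> X `` {e}"
proof -
  obtain e where e: "epic \<A> e" "src \<A> e = X" "Q = quotient_rel \<A> X `` {e}"
    using assms unfolding quotient_objects_def by (auto elim: quotientE)
  then have "e \<in> Hom \<A> X (tgt \<A> e)"
    by (auto simp: epic_def Hom_def)
  from ex_short_exact_epic[OF e(1) this] obtain A a where "short_exact \<A> A a X e (tgt \<A> e)" .
  then show thesis
    using that e(3) by blast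
qed

lemma quotient_objectI:
  "short_exact \<A> A a X e Y \<Longrightarrow> quotient_rel \<A> X `` {e} \<in> quotient_objects \<A> X"
  unfolding quotient_objects_def
  by (intro quotientI CollectI conjI short_exactD(6) Hom_arrow(2)[OF short_exactD(2)])

text \<open>
  A cokernel of any representative of the subobject is also a cokernel of \<open>a\<close>, and the cokernels of \<open>a\<close> are
  the arrows isomorphic to \<open>e\<close> under \<open>X\<close>.
\<close>

lemma quotient_by_subobject_class:
  assumes a: "short_exact \<A> A a X e Y"
  shows "quotient_by \<A> (subobject_rel \<A> X `` {a}) = quotient_rel \<A> X `` {e}"
proof (intro equalityI subsetI)
  note aD = short_exactD[OF a]
  {
    fix p
    assume "p \<in> quotient_by \<A> (subobject_rel \<A> X `` {a})"
    then obtain i where i: "(a, i) \<in> subobject_rel \<A> X" and p: "is_cokernel \<A> p i"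
      unfolding quotient_by_def by blast
    obtain B h where iH: "i \<in> Hom \<A> B X" and h: "h \<in> Hom \<A> A B" "iso_arr \<A> h" "a = i \<cdot> h"
      using i aD(1) unfolding subobject_rel_def monic_def Hom_def by auto
    have pH: "p \<in> Hom \<A> X (tgt \<A> p)"
      using cokernel_Hom[OF p iH] .
    obtain g where g: "g \<in> Hom \<A> B A" "h \<cdot> g = ident \<A> B"
      using iso_arrE[OF h(2,1)] by blast
    have "p \<cdot> a = zero_arr \<A> A (tgt \<A> p)"
      using comp_assoc[OF h(1) iH pH] h(3) cokernel_zero[OF p pH iH]
        zero_comp[OF Hom_objects(2)[OF pH] h(1)] by simp
    then obtain u where u: "u \<in> Hom \<A> Y (tgt \<A> p)" "u \<cdot> e = p"
      using short_exact_colift[OF a pH] by blast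
    have "i = a \<cdot> g"
      using comp_assoc[OF g(1) h(1) iH] h(3) g(2) ident_right[OF iH] by simp
    then have "e \<cdot> i = zero_arr \<A> B Y"
      using comp_assoc[OF g(1) aD(1,2)] aD(7) zero_comp[OF aD(10) g(1)] by simp
    then obtain v where v: "v \<in> Hom \<A> (tgt \<A> p) Y" "v \<cdot> p = e"
      using cokernel_lift[OF p pH iH aD(2)] by blast
    have "iso_arr \<A> u"
      using epic_mutual_iso[OF aD(6,2) cokernel_epic[OF p] pH u(1) u(2)[symmetric] v(1) v(2)[symmetric]] .
    then show "p \<in> quotient_rel \<A> X `` {e}"
      using aD(2,6) u cokernel_epic[OF p] pH unfolding quotient_rel_def Hom_def by auto
  next
    fix p
    assume "p \<in> quotient_rel \<A> X `` {e}"
    then obtain h where p: "epic \<A> p" "src \<A> p = X" and h: "h \<in> Hom \<A> Y (tgt \<A> p)" "iso_arr \<A> h"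
      "p = h \<cdot> e"
      using aD(2) unfolding quotient_rel_def Hom_def by auto
    have pH: "p \<in> Hom \<A> X (tgt \<A> p)"
      using p by (auto simp: epic_def Hom_def)
    obtain g where g: "g \<in> Hom \<A> (tgt \<A> p) Y" "g \<cdot> h = ident \<A> Y"
      using iso_arrE[OF h(2,1)] by blast
    have "is_cokernel \<A> p a"
    proof (rule is_cokernelI[OF pH p(1) aD(1)])
      show "p \<cdot> a = zero_arr \<A> A (tgt \<A> p)"
        using comp_assoc[OF aD(1,2) h(1)] h(3) aD(7) comp_zero[OF aD(8) h(1)] by simp
      fix W f
      assume "f \<in> Hom \<A> X W" "f \<cdot> a = zero_arr \<A> A W"
      then obtain w where w: "w \<in> Hom \<A> Y W" "w \<cdot> e = f"
        using short_exact_colift[OF a] by blast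
      have "g \<cdot> p = e"
        using comp_assoc[OF aD(2) h(1) g(1)] h(3) g(2) ident_left[OF aD(2)] by simp
      then have "(w \<cdot> g) \<cdot> p = f"
        using comp_assoc[OF pH g(1) w(1)] w(2) by simp
      then show "\<exists>h \<in> Hom \<A> (tgt \<A> p) W. h \<cdot> p = f"
        using comp_Hom[OF g(1) w(1)] by blast
    qed
    then show "p \<in> quotient_by \<A> (subobject_rel \<A> X `` {a})"
      unfolding quotient_by_def using subobject_rel_refl[OF aD(5,1)] by blast
  }
qed

text \<open>
  The condition ranges over all composition series of all representatives of the quotient. Jordan--Hoelder
  reduces it to a single one, and the existence of a series for \<open>Y\<close> ensures that it does not hold vacuously.
\<close>

lemma quotient_has_factors_iff:
  assumes X: "X \<in> objects \<A>" and IS: "nonisomorphic_simple_factors \<A> X I S"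
    and a: "short_exact \<A> A a X e Y" and K: "K \<subseteq> I"
  shows "quotient_has_factors \<A> (quotient_rel \<A> X `` {e}) S K \<longleftrightarrow>
    factor_set \<A> Y = (iso_class \<A> \<circ> S) ` K"
proof -
  note ns = nonisomorphic_simple_factorsD[OF X IS] and aD = short_exactD[OF a]
  let ?c = "iso_class \<A> \<circ> S"
  have Y: "multiplicity_free \<A> Y"
    using multiplicity_free_short_exact[OF ns(4) a] by blast
  have fin: "finite K" and S: "\<forall>i \<in> K. S i \<in> objects \<A>"
    using finite_subset[OF K ns(1)] ns(2) K by auto
  note match = ex_factor_matching_iff[OF fin inj_on_subset[OF ns(3) K] S]
  show ?thesis
  proof
    assume L: "quotient_has_factors \<A> (quotient_rel \<A> X `` {e}) S K"
    have "e \<in> quotient_rel \<A> X `` {e}" "tgt \<A> e = Y"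
      using equiv_class_self[OF equiv_quotient_rel] aD(2,6) by (auto simp: Hom_def)
    moreover obtain Ts where Ts: "has_series \<A> Y Ts"
      using Y by (auto simp: multiplicity_free_def)
    moreover obtain B where B: "composition_series \<A> Y (length Ts) B (\<lambda>k. Ts ! (k - 1))"
      using has_series_composition_series[OF Ts] .
    ultimately have "\<exists>\<phi>. factor_matching \<A> K S (length Ts) (\<lambda>k. Ts ! (k - 1)) \<phi>"
      using L unfolding quotient_has_factors_def by blast
    then have "factors \<A> Y = mset_set (?c ` K)"
      using match[OF composition_series_objects[OF B]] factors_eq[OF Ts]
      unfolding map_nth_pred by simp
    then show "factor_set \<A> Y = ?c ` K"
      using fin by simp
  next
    assume R: "factor_set \<A> Y = ?c ` K"
    show "quotient_has_factors \<A> (quotient_rel \<A> X `` {e}) S K"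
      unfolding quotient_has_factors_def
    proof (intro ballI allI impI)
      fix p n B T
      assume p: "p \<in> quotient_rel \<A> X `` {e}" and B: "composition_series \<A> (tgt \<A> p) n B T"
      obtain h where h: "h \<in> Hom \<A> Y (tgt \<A> p)" "iso_arr \<A> h"
        using p aD(2) unfolding quotient_rel_def Hom_def by auto
      obtain g where g: "g \<in> Hom \<A> (tgt \<A> p) Y" "iso_arr \<A> g"
        using iso_arrE[OF h(2,1)] by blast
      have "has_series \<A> Y (map T [1..<Suc n])"
        using has_series_iso[OF composition_series_has_series[OF B] g(2,1)] Hom_objects[OF g(1)]
        by blast
      then show "\<exists>\<phi>. factor_matching \<A> K S n T \<phi>"
        using match[OF composition_series_objects[OF B]] factors_eq multiplicity_free_factors[OF Y] R
        by metis
    qed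
  qed
qed

lemma ex1_quotient_with_factors:
  assumes X: "X \<in> objects \<A>" and IS: "nonisomorphic_simple_factors \<A> X I S"
    and K: "q_set \<A> X I S K"
  shows "\<exists>!Q. Q \<in> quotient_objects \<A> X \<and> quotient_has_factors \<A> Q S K" (is "\<exists>!Q. ?P Q")
    and "\<exists>U \<in> subobjects \<A> X. quotient_by \<A> U \<in> quotient_objects \<A> X \<and>
      quotient_has_factors \<A> (quotient_by \<A> U) S K"
proof -
  note ns = nonisomorphic_simple_factorsD[OF X IS] and qhf = quotient_has_factors_iff[OF X IS]
  obtain A a e Y where a: "short_exact \<A> A a X e Y" and Y: "factor_set \<A> Y = (iso_class \<A> \<circ> S) ` K"
    and KI: "K \<subseteq> I"
    using K unfolding q_set_iff[OF X IS] by (elim conjE exE) (rule that)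
  have P: "?P (quotient_rel \<A> X `` {e})"
    using quotient_objectI[OF a] qhf[OF a KI] Y by blast
  have "Q = quotient_rel \<A> X `` {e}" if Q: "?P Q" for Q
  proof -
    obtain B b f Z where b: "short_exact \<A> B b X f Z" "Q = quotient_rel \<A> X `` {f}"
      using quotient_objectE[OF conjunct1[OF Q]] .
    then have "factor_set \<A> Z = factor_set \<A> Y"
      using iffD1[OF qhf[OF b(1) KI]] Q Y unfolding b(2) by simp
    then obtain h where "h \<in> Hom \<A> Y Z" "iso_arr \<A> h" "f = h \<cdot> e"
      using quotient_unique[OF ns(4) a b(1)] by blast
    then have "(e, f) \<in> quotient_rel \<A> X"
      using short_exactD(2,6)[OF a] short_exactD(2,6)[OF b(1)]
      unfolding quotient_rel_def Hom_def by auto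
    then show ?thesis
      using equiv_class_eq[OF equiv_quotient_rel] b(2) by blast
  qed
  with P show "\<exists>!Q. ?P Q"
    by blast
  show "\<exists>U \<in> subobjects \<A> X. quotient_by \<A> U \<in> quotient_objects \<A> X \<and>
      quotient_has_factors \<A> (quotient_by \<A> U) S K"
    using P quotient_by_subobject_class[OF a] subobject_class[OF short_exactD(5,1)[OF a]] by metis
qed

lemma ex1_q_set_of_quotient:
  assumes X: "X \<in> objects \<A>" and IS: "nonisomorphic_simple_factors \<A> X I S"
    and Q: "Q \<in> quotient_objects \<A> X"
  shows "\<exists>!K. q_set \<A> X I S K \<and> quotient_has_factors \<A> Q S K"
proof -
  note ns = nonisomorphic_simple_factorsD[OF X IS]
  let ?c = "iso_class \<A> \<circ> S"
  obtain A a e Y where a: "short_exact \<A> A a X e Y" "Q = quotient_rel \<A> X `` {e}"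
    using quotient_objectE[OF Q] .
  have *: "q_set \<A> X I S K \<and> quotient_has_factors \<A> Q S K \<longleftrightarrow> K \<subseteq> I \<and> factor_set \<A> Y = ?c ` K" for K
  proof (cases "K \<subseteq> I")
    case True
    have "q_set \<A> X I S K" if "factor_set \<A> Y = ?c ` K"
      unfolding q_set_iff[OF X IS] using True a(1) that by (intro conjI exI)
    then show ?thesis
      using True quotient_has_factors_iff[OF X IS a(1) True] unfolding a(2) by blast
  next
    case False
    then show ?thesis
      by (simp add: q_set_def)
  qed
  have "factor_set \<A> Y \<subseteq> ?c ` I"
    using multiplicity_free_short_exact(3)[OF ns(4) a(1)] ns(5) by blast
  then obtain K where "K \<subseteq> I" "factor_set \<A> Y = ?c ` K"
    by (meson subset_imageE)
  moreover have "K' = K" if "K' \<subseteq> I" "K \<subseteq> I" "?c ` K' = ?c ` K" for K'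
    using inj_on_image_eq_iff[OF ns(3)] that by blast
  ultimately show ?thesis
    unfolding * by (intro ex1I[of _ K]) auto
qed

end

theorem proposition3p9:
  fixes \<A> :: "('o, 'm) additive_data" and X :: 'o and I :: "'i set" and S :: "'i \<Rightarrow> 'o"
  assumes "abelian_category \<A>" and "finite_length \<A>"
    and "X \<in> objects \<A>" and "nonisomorphic_simple_factors \<A> X I S"
  shows "(\<forall>K. q_set \<A> X I S K \<longrightarrow>
            (\<exists>!Q. Q \<in> quotient_objects \<A> X \<and> quotient_has_factors \<A> Q S K) \<and>
            (\<exists>U \<in> subobjects \<A> X. quotient_by \<A> U \<in> quotient_objects \<A> X \<and>
               quotient_has_factors \<A> (quotient_by \<A> U) S K)) \<and>
         bij_betw (\<lambda>K. THE Q. Q \<in> quotient_objects \<A> X \<and> quotient_has_factors \<A> Q S K)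
           {K. q_set \<A> X I S K} (quotient_objects \<A> X)"
proof -
  interpret abelian_category \<A>
    using assms(1) .
  note Q = ex1_quotient_with_factors[OF assms(3,4)]
    and K = ex1_q_set_of_quotient[OF assms(3,4)]
  let ?P = "\<lambda>K Q. Q \<in> quotient_objects \<A> X \<and> quotient_has_factors \<A> Q S K"
  have the: "?P K (THE Q. ?P K Q)" if "q_set \<A> X I S K" for K
    using theI'[OF Q(1)[OF that]] .
  have "bij_betw (\<lambda>K. THE Q. ?P K Q) {K. q_set \<A> X I S K} (quotient_objects \<A> X)"
  proof (rule bij_betw_imageI)
    show "inj_on (\<lambda>K. THE Q. ?P K Q) {K. q_set \<A> X I S K}"
    proof (rule inj_onI)
      fix K L
      assume KL: "K \<in> {K. q_set \<A> X I S K}" "L \<in> {K. q_set \<A> X I S K}"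
        and eq: "(THE Q. ?P K Q) = (THE Q. ?P L Q)"
      have PK: "?P K (THE Q. ?P K Q)"
        using the[OF CollectD[OF KL(1)]] .
      have PL: "?P L (THE Q. ?P K Q)"
        using the[OF CollectD[OF KL(2)]] unfolding eq .
      show "K = L"
        by (rule ex1E[OF K[OF conjunct1[OF PK]]]) (metis KL PK PL mem_Collect_eq)
    qed
    show "(\<lambda>K. THE Q. ?P K Q) ` {K. q_set \<A> X I S K} = quotient_objects \<A> X"
    proof (intro equalityI subsetI)
      fix R
      assume "R \<in> (\<lambda>K. THE Q. ?P K Q) ` {K. q_set \<A> X I S K}"
      then show "R \<in> quotient_objects \<A> X"
        using the by blast
    next
      fix R
      assume R: "R \<in> quotient_objects \<A> X"
      then obtain L where L: "q_set \<A> X I S L" "quotient_has_factors \<A> R S L"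
        using K by blast
      have "(THE Q. ?P L Q) = R"
        using the1_equality[OF Q(1)[OF L(1)]] R L(2) by blast
      then show "R \<in> (\<lambda>K. THE Q. ?P K Q) ` {K. q_set \<A> X I S K}"
        using L(1) by blast
    qed
  qed
  then show ?thesis
    using Q by blast
qed

end
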